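(* Let $A$ be a finitely generated commutative associative algebra over a field $F$ and let $B$ be a finitely generated subalgebra of $A$. Then $B$ is undistorted in $A$.
   Context: The degree filtration $\{A_n\}_{n\ge 0}$ of an associative algebra $A$ generated by a finite set $X$ is defined by letting $A_n$ be the linear span of all products of at most $n$ elements of $X$. In the setting of unital algebras (subalgebras containing the same $1$) the empty product $1$ is included, so $A_0=F\cdot 1$; in the non-unital setting $A_0=0$. A finitely generated subalgebra $B$ of a finitely generated algebra $A$ is undistorted in $A$ (embedded without distortion) if for degree filtrations $\{A_n\}$ of $A$ and $\{B_n\}$ of $B$ (defined by some finite generating sets; the property does not depend on their choice) the filtrations $\{B_n\}$ and $\{B\cap A_n\}$ of $B$ are equivalent, i.e. there is an integer $t>0$ with $B_n\subset A_{tn}$ and $B\cap A_n\subset B_{tn}$ for all $n\ge 0$. *)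

theory Defs
  imports Main "HOL.Vector_Spaces"
begin

text \<open>
  The type class \<^class>\<open>ring\<close> does not require an identity.  The parameter \<open>one\<close> selects the
  category: \<open>None\<close> for algebras without a distinguished identity, \<open>Some e\<close> for unital algebras
  with identity \<open>e\<close>, whose subalgebras contain the same \<open>e\<close>.  The identity is a parameter, rather
  than the constant \<open>1\<close> of \<^class>\<open>ring_1\<close>, because \<^class>\<open>ring_1\<close> excludes the zero algebra.
\<close>

locale assoc_algebra = vector_space scale
  for scale :: "'f::field \<Rightarrow> 'a::ring \<Rightarrow> 'a" +
  fixes one :: "'a option"
  assumes scale_mult_left: "scale c x * y = scale c (x * y)"
    and scale_mult_right: "x * scale c y = scale c (x * y)"
    and one_identity: "one = Some e \<Longrightarrow> e * x = x \<and> x * e = x"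
begin

definition subalgebra :: "'a set \<Rightarrow> bool" where
  "subalgebra B \<longleftrightarrow> subspace B \<and> (\<forall>x\<in>B. \<forall>y\<in>B. x * y \<in> B) \<and> set_option one \<subseteq> B"

definition generates :: "'a set \<Rightarrow> 'a set \<Rightarrow> bool" where
  "generates X B \<longleftrightarrow> subalgebra hull X = B"

definition finitely_generated :: "'a set \<Rightarrow> bool" where
  "finitely_generated B \<longleftrightarrow> (\<exists>X. finite X \<and> generates X B)"

text \<open>
  A nonempty product \<open>x\<^sub>1 * \<dots> * x\<^sub>k\<close> is written without reference to an identity as
  \<open>foldr (*) [x\<^sub>1, \<dots>, x\<^sub>k\<^sub>-\<^sub>1] x\<^sub>k\<close>; the empty product is present exactly in the unital case.
\<close>

definition degree_filtration :: "'a set \<Rightarrow> nat \<Rightarrow> 'a set" where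
  "degree_filtration X n =
     span (set_option one \<union>
       {foldr (*) (butlast xs) (last xs) | xs. xs \<noteq> [] \<and> set xs \<subseteq> X \<and> length xs \<le> n})"

text \<open>
  The property does not depend on the choice of the finite generating sets; it is required
  here for all choices, and such choices exist by the first two conjuncts.
\<close>

definition undistorted :: "'a set \<Rightarrow> 'a set \<Rightarrow> bool" where
  "undistorted A B \<longleftrightarrow>
     finitely_generated A \<and> finitely_generated B \<and> B \<subseteq> A \<and>
     (\<forall>X Y. finite X \<longrightarrow> generates X A \<longrightarrow> finite Y \<longrightarrow> generates Y B \<longrightarrow>
       (\<exists>t>0. \<forall>n. degree_filtration Y n \<subseteq> degree_filtration X (t * n) \<and>
                  B \<inter> degree_filtration X n \<subseteq> degree_filtration Y (t * n)))"

end

end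

theory Submission
  imports Defs "HOL-Library.Product_Plus"
begin

text \<open>
  The inclusion of \<open>B\<^sub>n\<close> in \<open>A\<^sub>t\<^sub>n\<close> only expresses that the generators of \<open>B\<close> are polynomials in
  those of \<open>A\<close>. The content is the other inclusion, \<open>B \<inter> A\<^sub>n \<subseteq> B\<^sub>t\<^sub>n\<close>.

  \<^bold>\<open>Operators instead of rings.\<close> An algebra with or without identity acts on its unitization
  \<open>F \<times> A\<close> by commuting linear operators, and \<open>A\<^sub>n\<close> is read off from the words of length at most \<open>n\<close>
  applied to the vector \<open>(1, 0)\<close>. The main argument is therefore about a vector space with
  commuting operators: given finite sets \<open>Y \<subseteq> Z\<close> of operators and finite sets \<open>S\<close>, \<open>T\<close> of vectors,
  with \<open>T\<close> in the \<open>Z\<close>-submodule generated by \<open>S\<close>, a vector that lies in the \<open>Y\<close>-submodule generated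
  by \<open>T\<close> and is reached from \<open>S\<close> by \<open>Z\<close>-words of length \<open>n\<close> is reached from \<open>T\<close> by \<open>Y\<close>-words of
  length \<open>tn + t\<close> (\<open>filt_undistorted\<close>).
  The form for modules, rather than only for algebras, makes the statement transitive, so that
  operators can be adjoined one at a time, \<open>Z = Y \<union> {x}\<close>.

  \<^bold>\<open>The same operators.\<close> When \<open>Y = Z\<close> the loss is an additive constant. This is an Artin-Rees
  statement (\<open>filt_comparison\<close>); it follows from a filtered Hilbert basis theorem
  (\<open>filtration_eventually_step\<close>), proved with leading coefficients by induction on the number of
  operators. The same theorem gives the ascending chain condition for submodules.

  \<^bold>\<open>One more operator.\<close> By Noetherian induction on a submodule \<open>N\<close>, the statement is proved modulo
  \<open>N\<close>. It passes to extensions of modules (\<open>undistorted_modulo_extension\<close>), so only cyclic quotients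
  generated by a vector \<open>u\<close> with prime annihilator matter.
  There are two cases. If \<open>x\<close> is algebraic, some relation has leading term \<open>a x\<^sup>d u\<close> with \<open>a\<close> a
  polynomial in \<open>Y\<close> that does not annihilate \<open>u\<close>. Multiplication by \<open>a\<^sup>n\<close> brings a vector of degree \<open>n\<close> into
  the finitely generated \<open>Y\<close>-module spanned by \<open>u, x u, \<dots>, x\<^sup>d\<^sup>-\<^sup>1 u\<close> at linear cost. Dividing by \<open>a\<close>
  costs a constant each time, by Artin-Rees and primality; hence dividing by \<open>a\<^sup>n\<close> also has linear cost.
  If \<open>x\<close> is transcendental, the sum of the \<open>Y\<close>-modules generated by the \<open>x\<^sup>i u\<close> is direct and powers
  of \<open>x\<close> above those occurring in \<open>T\<close> cannot contribute.
\<close>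

section \<open>Commuting operators on a vector space\<close>

locale commuting_operators = vector_space scale
  for scale :: "'f::field \<Rightarrow> 'v::ab_group_add \<Rightarrow> 'v" (infixr "*s" 75) +
  fixes Ops :: "('v \<Rightarrow> 'v) set"
  assumes Ops_add: "z \<in> Ops \<Longrightarrow> z (v + w) = z v + z w"
    and Ops_scale: "z \<in> Ops \<Longrightarrow> z (c *s v) = c *s z v"
    and Ops_commute: "z \<in> Ops \<Longrightarrow> z' \<in> Ops \<Longrightarrow> z (z' v) = z' (z v)"
begin

text \<open>
  The polynomials in the operators \<open>Z\<close>, as functions: only their action is used.
\<close>

inductive_set Pol :: "('v \<Rightarrow> 'v) set \<Rightarrow> ('v \<Rightarrow> 'v) set" for Z where
  Pol_id: "(\<lambda>v. v) \<in> Pol Z"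
| Pol_plus: "p \<in> Pol Z \<Longrightarrow> q \<in> Pol Z \<Longrightarrow> (\<lambda>v. p v + q v) \<in> Pol Z"
| Pol_smult: "p \<in> Pol Z \<Longrightarrow> (\<lambda>v. c *s p v) \<in> Pol Z"
| Pol_op: "z \<in> Z \<Longrightarrow> p \<in> Pol Z \<Longrightarrow> (\<lambda>v. z (p v)) \<in> Pol Z"

lemma Pol_mono: "p \<in> Pol Y \<Longrightarrow> Y \<subseteq> Z \<Longrightarrow> p \<in> Pol Z"
  by (induction rule: Pol.induct) (auto intro: Pol.intros)

lemma Pol_base: "z \<in> Z \<Longrightarrow> z \<in> Pol Z"
  using Pol_op[OF _ Pol_id] by simp

lemma Pol_comp: "p \<in> Pol Z \<Longrightarrow> q \<in> Pol Z \<Longrightarrow> (\<lambda>v. p (q v)) \<in> Pol Z"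
  by (induction rule: Pol.induct) (auto intro: Pol.intros)

lemma Pol_funpow: "p \<in> Pol Z \<Longrightarrow> (p ^^ i) \<in> Pol Z"
proof (induction i)
  case 0
  show ?case using Pol_id by (simp add: id_def)
next
  case (Suc i)
  then show ?case using Pol_comp[of p Z "p ^^ i"] by (simp add: o_def)
qed

lemma Pol_add: "p \<in> Pol Ops \<Longrightarrow> p (v + w) = p v + p w"
  by (induction rule: Pol.induct) (auto simp: scale_right_distrib Ops_add algebra_simps)

lemma Pol_scale: "p \<in> Pol Ops \<Longrightarrow> p (c *s v) = c *s p v"
  by (induction rule: Pol.induct) (auto simp: scale_right_distrib Ops_scale mult.commute)

lemma Pol_zero: "p \<in> Pol Ops \<Longrightarrow> p 0 = 0"
  using Pol_scale[of p 0 0] by simp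

lemma Pol_diff: "p \<in> Pol Ops \<Longrightarrow> p (v - w) = p v - p w"
  using Pol_add[of p "v - w" w] by (simp add: algebra_simps)

lemma Pol_commute_Ops: "p \<in> Pol Ops \<Longrightarrow> z \<in> Ops \<Longrightarrow> p (z v) = z (p v)"
  by (induction rule: Pol.induct) (auto simp: Ops_add Ops_scale Ops_commute)

lemma Pol_commute: "p \<in> Pol Ops \<Longrightarrow> q \<in> Pol Ops \<Longrightarrow> p (q v) = q (p v)"
  by (induction rule: Pol.induct) (auto simp: Pol_add Pol_scale Pol_commute_Ops)

lemma subspace_vimage_Pol: "p \<in> Pol Ops \<Longrightarrow> subspace U \<Longrightarrow> subspace {v. p v \<in> U}"
  unfolding subspace_def by (auto simp: Pol_add Pol_scale Pol_zero)

lemma subspace_image_Pol: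
  assumes "p \<in> Pol Ops" "subspace U"
  shows "subspace (p ` U)"
  unfolding subspace_def
proof (intro conjI ballI allI)
  show "0 \<in> p ` U" using subspace_0[OF assms(2)] Pol_zero[OF assms(1)] by (metis image_eqI)
next
  fix a b assume "a \<in> p ` U" "b \<in> p ` U"
  then show "a + b \<in> p ` U"
    using subspace_add[OF assms(2)] Pol_add[OF assms(1), symmetric] by auto
next
  fix c a assume "a \<in> p ` U"
  then show "c *s a \<in> p ` U"
    using subspace_scale[OF assms(2)] Pol_scale[OF assms(1), symmetric] by auto
qed

lemma Pol_span:
  assumes "p \<in> Pol Ops" "subspace U" "\<And>v. v \<in> S \<Longrightarrow> p v \<in> U" "v \<in> span S"
  shows "p v \<in> U"
  using span_minimal[OF _ subspace_vimage_Pol[OF assms(1,2)], of S] assms(3,4) by blast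

definition step :: "('v \<Rightarrow> 'v) set \<Rightarrow> 'v set \<Rightarrow> 'v set" where
  "step Z V = span (V \<union> (\<Union>z\<in>Z. z ` V))"

text \<open>
  The set \<open>S\<close> may be infinite. For a submodule \<open>N\<close>, generating from \<open>S \<union> N\<close> instead of \<open>S\<close> encodes
  working modulo \<open>N\<close> without forming a quotient (see \<open>filt_Un_submodule\<close> below).
\<close>

fun filt :: "('v \<Rightarrow> 'v) set \<Rightarrow> 'v set \<Rightarrow> nat \<Rightarrow> 'v set" where
  "filt Z S 0 = span S"
| "filt Z S (Suc n) = step Z (filt Z S n)"

declare filt.simps(2) [simp del]

definition gen :: "('v \<Rightarrow> 'v) set \<Rightarrow> 'v set \<Rightarrow> 'v set" where
  "gen Z S = (\<Union>n. filt Z S n)"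

definition submodule :: "('v \<Rightarrow> 'v) set \<Rightarrow> 'v set \<Rightarrow> bool" where
  "submodule Z N \<longleftrightarrow> subspace N \<and> (\<forall>z\<in>Z. \<forall>v\<in>N. z v \<in> N)"

definition filtration :: "('v \<Rightarrow> 'v) set \<Rightarrow> (nat \<Rightarrow> 'v set) \<Rightarrow> bool" where
  "filtration Z L \<longleftrightarrow> (\<forall>n. subspace (L n)) \<and> (\<forall>n. step Z (L n) \<subseteq> L (Suc n))"

lemma subspace_step: "subspace (step Z V)"
  by (simp add: step_def)

lemma step_base: "v \<in> V \<Longrightarrow> v \<in> step Z V"
  by (simp add: step_def span_base)

lemma step_op: "z \<in> Z \<Longrightarrow> v \<in> V \<Longrightarrow> z v \<in> step Z V"
  unfolding step_def by (rule span_base) blast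

lemma step_minimal:
  assumes "subspace U" "V \<subseteq> U" "\<And>z v. z \<in> Z \<Longrightarrow> v \<in> V \<Longrightarrow> z v \<in> U"
  shows "step Z V \<subseteq> U"
  unfolding step_def using assms by (intro span_minimal) auto

lemma step_mono: "V \<subseteq> W \<Longrightarrow> Y \<subseteq> Z \<Longrightarrow> step Y V \<subseteq> step Z W"
  by (rule step_minimal[OF subspace_step]) (auto intro: step_base step_op)

lemma filtrationI:
  assumes "\<And>n. subspace (L n)" "\<And>n v. v \<in> L n \<Longrightarrow> v \<in> L (Suc n)"
    "\<And>n z v. z \<in> Z \<Longrightarrow> v \<in> L n \<Longrightarrow> z v \<in> L (Suc n)"
  shows "filtration Z L"
  unfolding filtration_def using step_minimal[of "L (Suc n)" "L n" Z for n] assms by blast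

lemma filtrationD:
  assumes "filtration Z L"
  shows "subspace (L n)" "v \<in> L n \<Longrightarrow> v \<in> L (Suc n)" "z \<in> Z \<Longrightarrow> v \<in> L n \<Longrightarrow> z v \<in> L (Suc n)"
  using assms unfolding filtration_def by (auto intro: step_base step_op)

lemma filtration_mono:
  assumes "filtration Z L" "m \<le> n" "v \<in> L m"
  shows "v \<in> L n"
  using assms(2,3) by (induction rule: dec_induct) (auto intro: filtrationD[OF assms(1)])

lemma filtration_filt: "filtration Z (filt Z S)"
proof -
  have "subspace (filt Z S n)" for n by (cases n) (simp_all add: subspace_step filt.simps(2))
  then show ?thesis by (simp add: filtration_def filt.simps(2))
qed

lemmas subspace_filt = filtrationD(1)[OF filtration_filt]
lemmas filt_mono = filtration_mono[OF filtration_filt]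
lemmas filt_op = filtrationD(3)[OF filtration_filt]

lemma filt_base: "v \<in> S \<Longrightarrow> v \<in> filt Z S n"
  by (rule filt_mono[of 0]) (simp_all add: span_base)

text \<open>
  The main tool for bounding \<open>filt\<close> from above: it is the smallest filtration containing \<open>S\<close> in
  degree \<open>0\<close>.
\<close>

lemma filt_least:
  assumes "filtration Z Q" "S \<subseteq> Q 0"
  shows "filt Z S n \<subseteq> Q n"
proof (induction n)
  case 0
  then show ?case using span_minimal[OF assms(2)] filtrationD(1)[OF assms(1)] by simp
next
  case (Suc n)
  then have "filt Z S (Suc n) \<subseteq> step Z (Q n)" by (simp add: step_mono filt.simps(2))
  then show ?case using assms(1) unfolding filtration_def by blast
qed

lemma filtration_subset: "filtration Z L \<Longrightarrow> Y \<subseteq> Z \<Longrightarrow> filtration Y L"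
  unfolding filtration_def using step_mono by blast

lemma filtration_shift: "filtration Z L \<Longrightarrow> filtration Z (\<lambda>n. L (n + k))"
  unfolding filtration_def by simp

lemma filt_trans:
  assumes "T \<subseteq> filt Z S k" "Y \<subseteq> Z"
  shows "filt Y T n \<subseteq> filt Z S (n + k)"
  by (rule filt_least[OF filtration_subset[OF filtration_shift[OF filtration_filt] assms(2)]])
    (use assms(1) in simp)

lemma filt_mono_gens: "T \<subseteq> S \<Longrightarrow> Y \<subseteq> Z \<Longrightarrow> filt Y T n \<subseteq> filt Z S n"
  using filt_trans[of T Z S 0 Y n] by (auto intro: span_base)

lemma filt_Pol_commute:
  assumes "p \<in> Pol Ops" "Z \<subseteq> Ops" "filtration Z Q" "p ` S \<subseteq> Q 0" "v \<in> filt Z S n"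
  shows "p v \<in> Q n"
proof -
  have "filtration Z (\<lambda>n. {v. p v \<in> Q n})"
    using assms(1-3)
    by (intro filtrationI) (auto simp: subspace_vimage_Pol filtrationD Pol_commute_Ops subset_iff)
  from filt_least[OF this, of S n] assms(4,5) show ?thesis by auto
qed

lemma submodule_gen: "submodule Z (gen Z S)"
proof -
  have "subspace (gen Z S)"
    unfolding subspace_def
  proof (intro conjI ballI allI)
    show "0 \<in> gen Z S" using subspace_0[OF subspace_filt] by (auto simp: gen_def)
  next
    fix v w assume "v \<in> gen Z S" "w \<in> gen Z S"
    then obtain m n where "v \<in> filt Z S m" "w \<in> filt Z S n" by (auto simp: gen_def)
    then have "v \<in> filt Z S (max m n)" "w \<in> filt Z S (max m n)"
      using filt_mono max.cobounded1 max.cobounded2 by blast+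
    then have "v + w \<in> filt Z S (max m n)" by (rule subspace_add[OF subspace_filt])
    then show "v + w \<in> gen Z S" by (auto simp: gen_def)
  next
    fix c v assume "v \<in> gen Z S"
    then obtain n where "v \<in> filt Z S n" by (auto simp: gen_def)
    then have "c *s v \<in> filt Z S n" by (rule subspace_scale[OF subspace_filt])
    then show "c *s v \<in> gen Z S" by (auto simp: gen_def)
  qed
  moreover have "z v \<in> gen Z S" if "z \<in> Z" "v \<in> gen Z S" for z v
    using that(2) filt_op[OF that(1)] by (force simp: gen_def)
  ultimately show ?thesis by (simp add: submodule_def)
qed

lemma gen_base: "v \<in> S \<Longrightarrow> v \<in> gen Z S"
  using filt_base by (auto simp: gen_def)

lemma filtI_gen: "v \<in> filt Z S n \<Longrightarrow> v \<in> gen Z S"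
  by (auto simp: gen_def)

lemma filtration_const: "submodule Z N \<Longrightarrow> filtration Z (\<lambda>_. N)"
  by (rule filtrationI) (auto simp: submodule_def)

lemma gen_minimal: "submodule Z N \<Longrightarrow> S \<subseteq> N \<Longrightarrow> gen Z S \<subseteq> N"
  using filt_least[OF filtration_const, of Z N S] by (auto simp: gen_def)

lemma submodule_subset: "submodule Z N \<Longrightarrow> Y \<subseteq> Z \<Longrightarrow> submodule Y N"
  by (auto simp: submodule_def)

lemma gen_mono: "S \<subseteq> gen Z T \<Longrightarrow> Y \<subseteq> Z \<Longrightarrow> gen Y S \<subseteq> gen Z T"
  using gen_minimal submodule_subset[OF submodule_gen] by blast

lemma finite_subset_gen:
  assumes "finite G" "G \<subseteq> gen Z S"
  obtains k where "G \<subseteq> filt Z S k"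
proof -
  have "\<exists>k. G \<subseteq> filt Z S k" using assms
  proof (induction)
    case (insert g G)
    then obtain k m where "G \<subseteq> filt Z S k" "g \<in> filt Z S m" by (auto simp: gen_def)
    then have "insert g G \<subseteq> filt Z S (max k m)"
      using filt_mono[of k "max k m"] filt_mono[of m "max k m"] by auto
    then show ?case by blast
  qed auto
  then show ?thesis using that by blast
qed

lemma submodule_Pol:
  assumes "submodule Z N" "p \<in> Pol Z" "v \<in> N"
  shows "p v \<in> N"
  using assms(2,1,3)
  by (induction) (auto simp: submodule_def subspace_add subspace_scale)

lemma submodule_Int: "submodule Z M \<Longrightarrow> submodule Z N \<Longrightarrow> submodule Z (M \<inter> N)"
  by (auto simp: submodule_def subspace_inter)

lemma submodule_vimage:
  assumes "p \<in> Pol Ops" "Z \<subseteq> Ops" "submodule Z N"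
  shows "submodule Z {v. p v \<in> N}"
  using assms by (auto simp: submodule_def subspace_vimage_Pol Pol_commute_Ops subset_iff)

lemma Pol_degree:
  assumes "p \<in> Pol Z"
  shows "\<exists>k. \<forall>L n v. filtration Z L \<longrightarrow> v \<in> L n \<longrightarrow> p v \<in> L (n + k)"
  using assms
proof (induction)
  case Pol_id
  show ?case by (rule exI[of _ 0]) simp
next
  case (Pol_plus p q)
  then obtain k l where kl: "\<And>L n v. filtration Z L \<Longrightarrow> v \<in> L n \<Longrightarrow> p v \<in> L (n + k)"
    "\<And>L n v. filtration Z L \<Longrightarrow> v \<in> L n \<Longrightarrow> q v \<in> L (n + l)" by metis
  show ?case
  proof (intro exI[of _ "max k l"] allI impI)
    fix L n v assume *: "filtration Z L" "v \<in> L n"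
    have "p v \<in> L (n + max k l)" "q v \<in> L (n + max k l)"
      using filtration_mono[OF *(1) _ kl(1)[OF *]] filtration_mono[OF *(1) _ kl(2)[OF *]] by auto
    then show "p v + q v \<in> L (n + max k l)"
      using filtrationD(1)[OF *(1)] subspace_add by blast
  qed
next
  case (Pol_smult p c)
  then show ?case using filtrationD(1) subspace_scale by metis
next
  case (Pol_op z p)
  then obtain k where k: "\<And>L n v. filtration Z L \<Longrightarrow> v \<in> L n \<Longrightarrow> p v \<in> L (n + k)" by metis
  show ?case
    by (rule exI[of _ "Suc k"]) (use k Pol_op.hyps filtrationD(3) in auto)
qed

lemma subspace_Pol_image: "subspace {p u |p. p \<in> Pol Z}"
  unfolding subspace_def
proof (intro conjI ballI allI)
  show "0 \<in> {p u |p. p \<in> Pol Z}" using Pol_smult[OF Pol_id, of 0 Z] by force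
next
  fix v w assume "v \<in> {p u |p. p \<in> Pol Z}" "w \<in> {p u |p. p \<in> Pol Z}"
  then obtain p q where "p \<in> Pol Z" "v = p u" "q \<in> Pol Z" "w = q u" by auto
  then show "v + w \<in> {p u |p. p \<in> Pol Z}" using Pol_plus[of p Z q] by force
next
  fix c v assume "v \<in> {p u |p. p \<in> Pol Z}"
  then obtain p where "p \<in> Pol Z" "v = p u" by auto
  then show "c *s v \<in> {p u |p. p \<in> Pol Z}" using Pol_smult[of p Z c] by force
qed

lemma gen_singleton:
  assumes "v \<in> gen Z {u}"
  obtains p where "p \<in> Pol Z" "v = p u"
proof -
  have "submodule Z {p u |p. p \<in> Pol Z}"
    unfolding submodule_def
  proof (intro conjI ballI subspace_Pol_image)
    fix z v assume "z \<in> Z" "v \<in> {p u |p. p \<in> Pol Z}"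
    then obtain p where "p \<in> Pol Z" "v = p u" by auto
    then show "z v \<in> {p u |p. p \<in> Pol Z}" using Pol_op[OF \<open>z \<in> Z\<close>, of p] by force
  qed
  moreover have "{u} \<subseteq> {p u |p. p \<in> Pol Z}" using Pol_id by force
  ultimately have "gen Z {u} \<subseteq> {p u |p. p \<in> Pol Z}" by (rule gen_minimal)
  with assms that show ?thesis by blast
qed

text \<open>
  Applying words to \<open>N\<close> leads nowhere new, so generating from \<open>S \<union> N\<close> adds \<open>N\<close> itself in every
  degree. Hence membership in \<open>filt Z (S \<union> N) n\<close> means degree at most \<open>n\<close> modulo \<open>N\<close>.
\<close>

lemma filt_Un_submodule:
  assumes "Z \<subseteq> Ops" "submodule Z N" "v \<in> filt Z (S \<union> N) n"
  obtains w where "w \<in> N" "v - w \<in> filt Z S n"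
proof -
  let ?Q = "\<lambda>n. {a + b |a b. a \<in> filt Z S n \<and> b \<in> N}"
  have N: "subspace N" "\<And>z v. z \<in> Z \<Longrightarrow> v \<in> N \<Longrightarrow> z v \<in> N"
    using assms(2) by (auto simp: submodule_def)
  have "filtration Z ?Q"
  proof (rule filtrationI)
    show "subspace (?Q n)" for n using subspace_sums[OF subspace_filt N(1)] .
    show "v \<in> ?Q n \<Longrightarrow> v \<in> ?Q (Suc n)" for n v
      using filtrationD(2)[OF filtration_filt] by blast
    show "z \<in> Z \<Longrightarrow> v \<in> ?Q n \<Longrightarrow> z v \<in> ?Q (Suc n)" for n z v
    proof -
      assume z: "z \<in> Z" and "v \<in> ?Q n"
      then obtain a b where ab: "a \<in> filt Z S n" "b \<in> N" "v = a + b" by blast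
      have "z v = z a + z b" using z assms(1) ab(3) Ops_add by blast
      then show ?thesis using filt_op[OF z ab(1)] N(2)[OF z ab(2)] by blast
    qed
  qed
  moreover have "S \<union> N \<subseteq> ?Q 0"
  proof
    fix v assume "v \<in> S \<union> N"
    then have "(v \<in> span S \<and> 0 \<in> N) \<or> (0 \<in> span S \<and> v \<in> N)"
      using subspace_0[OF N(1)] by (auto simp: span_base span_zero)
    then show "v \<in> ?Q 0" by force
  qed
  ultimately have "v \<in> ?Q n" using filt_least assms(3) by blast
  then obtain a b where "a \<in> filt Z S n" "b \<in> N" "v = a + b" by blast
  then show ?thesis using that[of b] by simp
qed

text \<open>
  A basis of the union of the chain is finite, so it already lies in one member.
\<close>

lemma span_chain_stabilizes:
  assumes "finite F" "\<And>i. subspace (V i)" "\<And>i. V i \<subseteq> V (Suc i)" "\<And>i. V i \<subseteq> span F"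
  obtains k where "\<And>i. V i \<subseteq> V k"
proof -
  let ?U = "\<Union>i. V i"
  obtain C where C: "C \<subseteq> ?U" "independent C" "?U \<subseteq> span C"
    using maximal_independent_subset by blast
  have "C \<subseteq> span F" using C(1) assms(4) by blast
  then have "finite C" using independent_span_bound[OF assms(1) C(2)] by simp
  moreover have mono: "i \<le> j \<Longrightarrow> V i \<subseteq> V j" for i j
    using lift_Suc_mono_le[of V] assms(3) by blast
  ultimately have "\<exists>k. C \<subseteq> V k" using C(1)
  proof (induction C)
    case (insert c C)
    then obtain k i where "C \<subseteq> V k" "c \<in> V i" by auto
    then have "insert c C \<subseteq> V (max k i)"
      using mono[of k "max k i"] mono[of i "max k i"] by auto
    then show ?case by blast
  qed auto
  then obtain k where "C \<subseteq> V k" by blast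
  then have "?U \<subseteq> V k" using C(3) span_minimal[OF _ assms(2)] by blast
  then show ?thesis using that by blast
qed

lemma filt_finite_dim:
  assumes "finite Z" "Z \<subseteq> Ops" "finite S"
  obtains F where "finite F" "filt Z S n \<subseteq> span F"
proof -
  have "\<exists>F. finite F \<and> filt Z S n \<subseteq> span F"
  proof (induction n)
    case 0
    show ?case using assms(3) by auto
  next
    case (Suc n)
    then obtain F where F: "finite F" "filt Z S n \<subseteq> span F" by blast
    let ?F = "F \<union> (\<Union>z\<in>Z. z ` F)"
    have "step Z (filt Z S n) \<subseteq> span ?F"
    proof (rule step_minimal)
      show "filt Z S n \<subseteq> span ?F" using F(2) span_mono[of F ?F] by blast
    next
      fix z v assume zv: "z \<in> Z" "v \<in> filt Z S n"
      have "z \<in> Pol Ops" using zv(1) assms(2) Pol_base by blast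
      then show "z v \<in> span ?F"
      proof (rule Pol_span[where S = F])
        fix w assume "w \<in> F" then show "z w \<in> span ?F" using zv(1) by (intro span_base) blast
      qed (use zv F in auto)
    qed simp
    then show ?case using F(1) assms(1) by (intro exI[of _ ?F]) (auto simp: filt.simps(2))
  qed
  then show ?thesis using that by blast
qed

section \<open>A filtered Hilbert basis theorem\<close>

text \<open>
  Vectors \<open>\<Sum>j<i. x\<^sup>j v\<^sub>j\<close> of total degree at most \<open>m\<close>, with \<open>v\<^sub>j\<close> of degree \<open>m - j\<close> over \<open>Z\<close>: the
  vectors of \<open>x\<close>-degree less than \<open>i\<close>. The bound \<open>j \<le> m\<close> prevents truncated subtraction from
  admitting large powers of \<open>x\<close>.
\<close>

definition lower :: "('v \<Rightarrow> 'v) \<Rightarrow> ('v \<Rightarrow> 'v) set \<Rightarrow> 'v set \<Rightarrow> nat \<Rightarrow> nat \<Rightarrow> 'v set" where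
  "lower x Z S i m = span (\<Union>j\<in>{j. j < i \<and> j \<le> m}. (x ^^ j) ` filt Z S (m - j))"

lemma subspace_lower: "subspace (lower x Z S i m)"
  by (simp add: lower_def)

lemma lower_base:
  assumes "j < i" "j \<le> m" "v \<in> filt Z S (m - j)"
  shows "(x ^^ j) v \<in> lower x Z S i m"
  unfolding lower_def using assms by (intro span_base) blast

lemma lower_minimal:
  assumes "subspace U" "\<And>j v. j < i \<Longrightarrow> j \<le> m \<Longrightarrow> v \<in> filt Z S (m - j) \<Longrightarrow> (x ^^ j) v \<in> U"
  shows "lower x Z S i m \<subseteq> U"
  unfolding lower_def using assms by (intro span_minimal) auto

lemma lower_Suc_base:
  assumes "v \<in> lower x Z S i m"
  shows "v \<in> lower x Z S i (Suc m)"
proof -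
  have "lower x Z S i m \<subseteq> lower x Z S i (Suc m)"
  proof (rule lower_minimal[OF subspace_lower])
    fix j v assume "j < i" "j \<le> m" "v \<in> filt Z S (m - j)"
    then show "(x ^^ j) v \<in> lower x Z S i (Suc m)"
      using filt_mono[of "m - j" "Suc m - j" v] by (intro lower_base) auto
  qed
  then show ?thesis using assms by blast
qed

lemma lower_mono_i:
  assumes "v \<in> lower x Z S i m" "i \<le> i'"
  shows "v \<in> lower x Z S i' m"
proof -
  have "lower x Z S i m \<subseteq> lower x Z S i' m"
    using assms(2) by (intro lower_minimal[OF subspace_lower] lower_base) auto
  then show ?thesis using assms by blast
qed

text \<open>
  With \<open>p = x\<^sup>i\<close>, \<open>U\<close> part of a filtration and \<open>W\<close> the vectors of smaller \<open>x\<close>-degree, this is the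
  space of leading coefficients of \<open>U\<close> in \<open>x\<close>-degree \<open>i\<close>.
\<close>

lemma subspace_lift:
  assumes "p \<in> Pol Ops" "subspace U" "subspace W"
  shows "subspace {v. \<exists>l\<in>U. l - p v \<in> W}"
  unfolding subspace_def mem_Collect_eq
proof (intro conjI ballI allI)
  show "\<exists>l\<in>U. l - p 0 \<in> W"
    using subspace_0[OF assms(2)] subspace_0[OF assms(3)] Pol_zero[OF assms(1)] by force
next
  fix v w assume "v \<in> {v. \<exists>l\<in>U. l - p v \<in> W}" "w \<in> {v. \<exists>l\<in>U. l - p v \<in> W}"
  then obtain l k where *: "l \<in> U" "k \<in> U" "l - p v \<in> W" "k - p w \<in> W" by auto
  have "(l + k) - p (v + w) = (l - p v) + (k - p w)" by (simp add: Pol_add[OF assms(1)])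
  then have "(l + k) - p (v + w) \<in> W" using subspace_add[OF assms(3) *(3,4)] by (simp only:)
  then show "\<exists>l\<in>U. l - p (v + w) \<in> W" using subspace_add[OF assms(2) *(1,2)] by blast
next
  fix c v assume "v \<in> {v. \<exists>l\<in>U. l - p v \<in> W}"
  then obtain l where *: "l \<in> U" "l - p v \<in> W" by auto
  have "c *s l - p (c *s v) = c *s (l - p v)"
    by (simp add: Pol_scale[OF assms(1)] scale_right_diff_distrib)
  then have "c *s l - p (c *s v) \<in> W" using subspace_scale[OF assms(3) *(2)] by simp
  then show "\<exists>l\<in>U. l - p (c *s v) \<in> W" using subspace_scale[OF assms(2) *(1)] by blast
qed

lemma Ops_pow: "x \<in> Ops \<Longrightarrow> (x ^^ i) \<in> Pol Ops"
  using Pol_base Pol_funpow by blast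

context
  fixes x :: "'v \<Rightarrow> 'v" and Z :: "('v \<Rightarrow> 'v) set" and S :: "'v set"
  assumes x: "x \<in> Ops" and Z: "Z \<subseteq> Ops"
begin

lemmas x_pow = Ops_pow[OF x]

lemma lower_op:
  assumes "z \<in> Z" "v \<in> lower x Z S i m"
  shows "z v \<in> lower x Z S i (Suc m)"
proof -
  have z: "z \<in> Pol Ops" using assms(1) Z Pol_base by blast
  have "lower x Z S i m \<subseteq> {v. z v \<in> lower x Z S i (Suc m)}"
  proof (rule lower_minimal)
    fix j v assume *: "j < i" "j \<le> m" "v \<in> filt Z S (m - j)"
    have "z v \<in> filt Z S (Suc m - j)"
      using filt_op[OF assms(1) *(3)] *(2) by (simp add: Suc_diff_le)
    then have "(x ^^ j) (z v) \<in> lower x Z S i (Suc m)" using * by (intro lower_base) auto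
    then show "(x ^^ j) v \<in> {v. z v \<in> lower x Z S i (Suc m)}"
      using Pol_commute[OF x_pow z] by simp
  qed (rule subspace_vimage_Pol[OF z subspace_lower])
  then show ?thesis using assms(2) by blast
qed

lemma lower_x:
  assumes "v \<in> lower x Z S i m"
  shows "x v \<in> lower x Z S (Suc i) (Suc m)"
proof -
  have z: "x \<in> Pol Ops" using x Pol_base by blast
  have "lower x Z S i m \<subseteq> {v. x v \<in> lower x Z S (Suc i) (Suc m)}"
  proof (rule lower_minimal)
    fix j v assume *: "j < i" "j \<le> m" "v \<in> filt Z S (m - j)"
    have "(x ^^ Suc j) v \<in> lower x Z S (Suc i) (Suc m)" using * by (intro lower_base) auto
    then show "(x ^^ j) v \<in> {v. x v \<in> lower x Z S (Suc i) (Suc m)}"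
      by simp
  qed (rule subspace_vimage_Pol[OF z subspace_lower])
  then show ?thesis using assms by blast
qed

lemma lower_top:
  assumes "v \<in> lower x Z S (Suc i) m" "i \<le> m"
  obtains w where "w \<in> filt Z S (m - i)" "v - (x ^^ i) w \<in> lower x Z S i m"
proof -
  let ?U = "{a + b |a b. a \<in> (x ^^ i) ` filt Z S (m - i) \<and> b \<in> lower x Z S i m}"
  have im: "subspace ((x ^^ i) ` filt Z S (m - i))"
    by (rule subspace_image_Pol[OF x_pow subspace_filt])
  have "lower x Z S (Suc i) m \<subseteq> ?U"
  proof (rule lower_minimal)
    show "subspace ?U" by (rule subspace_sums[OF im subspace_lower])
  next
    fix j v assume *: "j < Suc i" "j \<le> m" "v \<in> filt Z S (m - j)"
    show "(x ^^ j) v \<in> ?U"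
    proof (cases "j = i")
      case True
      then show ?thesis using * subspace_0[OF subspace_lower] by force
    next
      case False
      then have "(x ^^ j) v \<in> lower x Z S i m" using * by (intro lower_base) auto
      then show ?thesis using subspace_0[OF im] by force
    qed
  qed
  then obtain w b where "w \<in> filt Z S (m - i)" "b \<in> lower x Z S i m" "v = (x ^^ i) w + b"
    using assms(1) by blast
  then show ?thesis using that[of w] by simp
qed

lemma lower_degenerate:
  assumes "m < i"
  shows "lower x Z S (Suc i) m = lower x Z S i m"
proof -
  have "{j. j < Suc i \<and> j \<le> m} = {j. j < i \<and> j \<le> m}" using assms by auto
  then show ?thesis by (simp add: lower_def)
qed

lemma filt_insert_lower: "filt (insert x Z) S m \<subseteq> lower x Z S (Suc m) m"
proof (rule filt_least)
  show "filtration (insert x Z) (\<lambda>m. lower x Z S (Suc m) m)"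
  proof (rule filtrationI[OF subspace_lower])
    fix n v assume "v \<in> lower x Z S (Suc n) n"
    then show "v \<in> lower x Z S (Suc (Suc n)) (Suc n)"
      using lower_Suc_base lower_mono_i by (meson le_SucI order_refl)
  next
    fix n z v assume "z \<in> insert x Z" "v \<in> lower x Z S (Suc n) n"
    then show "z v \<in> lower x Z S (Suc (Suc n)) (Suc n)"
      using lower_x lower_op[of z v "Suc n" n] lower_mono_i by auto
  qed
  show "S \<subseteq> lower x Z S (Suc 0) 0"
    using lower_base[of 0 "Suc 0" 0 _ Z S x] by (auto simp: span_base)
qed

end

text \<open>
  This says that the Rees module \<open>\<Oplus>\<^sub>n L\<^sub>n\<close> is finitely generated over the Rees ring of the operators.
  As in Hilbert's proof, the coefficients of \<open>x\<^sup>i\<close> in vectors of \<open>L\<close> that have \<open>x\<close>-degree at most \<open>i\<close>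
  form filtrations \<open>D i\<close> over the remaining operators, which increase with \<open>i\<close>. By induction the
  union of the \<open>D i\<close> is determined by finitely many of its degrees, each finite-dimensional, so
  \<open>D i\<close> is constant from some \<open>i0\<close> on. Leading terms of high degree can then be removed: for \<open>i > i0\<close>
  with \<open>x\<close> times a vector of \<open>x\<close>-degree \<open>i - 1\<close>, and for the finitely many \<open>i \<le> i0\<close> by the
  induction hypothesis for \<open>D i\<close>.
\<close>

lemma filtration_eventually_step:
  assumes "finite Z" "Z \<subseteq> Ops" "finite S" "filtration Z L" "\<And>n. L n \<subseteq> filt Z S n"
  shows "\<exists>n0. \<forall>n\<ge>n0. L (Suc n) \<subseteq> step Z (L n)"
  using assms(1,2,4,5)
proof (induction Z arbitrary: L rule: finite_induct)
  case empty
  obtain F where F: "finite F" "filt {} S 0 \<subseteq> span F" using assms(3) by auto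
  have 1: "filt {} S n \<subseteq> filt {} S 0" for n
    using filt_least[of "{}" "\<lambda>_. span S" S n] by (auto simp: filtration_def step_def span_superset span_span)
  have "L i \<subseteq> L (Suc i)" for i using filtrationD(2)[OF empty(2)] by blast
  then obtain k where k: "\<And>i. L i \<subseteq> L k"
    using span_chain_stabilizes[of F L] F 1 empty filtrationD(1)[OF empty(2)] by blast
  show ?case
  proof (intro exI[of _ k] allI impI)
    fix n assume "k \<le> n"
    then show "L (Suc n) \<subseteq> step {} (L n)"
      using k[of "Suc n"] filtration_mono[OF empty(2), of k n] step_base by blast
  qed
next
  case (insert x Z)
  note L = insert.prems(2)
  have x: "x \<in> Ops" and Z: "Z \<subseteq> Ops" using insert.prems(1) by auto
  note LZ = filtration_subset[OF L subset_insertI]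
  define D where "D i n = {v \<in> filt Z S n. \<exists>l\<in>L (n + i). l - (x ^^ i) v \<in> lower x Z S i (n + i)}" for i n
  note pow = Ops_pow[OF x]
  have DI: "v \<in> filt Z S n \<Longrightarrow> l \<in> L (n + i) \<Longrightarrow> l - (x ^^ i) v \<in> lower x Z S i (n + i) \<Longrightarrow> v \<in> D i n"
    for v n l i unfolding D_def by blast
  have DE: "v \<in> filt Z S n \<and> (\<exists>l. l \<in> L (n + i) \<and> l - (x ^^ i) v \<in> lower x Z S i (n + i))"
    if "v \<in> D i n" for v n i using that unfolding D_def by blast
  have D_filtration: "filtration Z (D i)" for i
  proof (rule filtrationI)
    fix n
    have "D i n = filt Z S n \<inter> {v. \<exists>l\<in>L (n + i). l - (x ^^ i) v \<in> lower x Z S i (n + i)}"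
      by (auto simp: D_def)
    then show "subspace (D i n)"
      using subspace_inter[OF subspace_filt subspace_lift[OF pow filtrationD(1)[OF L] subspace_lower]]
      by simp
  next
    fix n v assume "v \<in> D i n"
    with DE obtain l where *: "v \<in> filt Z S n" "l \<in> L (n + i)"
      "l - (x ^^ i) v \<in> lower x Z S i (n + i)" by metis
    then show "v \<in> D i (Suc n)"
      using DI[of v "Suc n" l i] filtrationD(2)[OF L] lower_Suc_base
        filtrationD(2)[OF filtration_filt, of v Z S n] by simp
  next
    fix n z v assume "z \<in> Z" "v \<in> D i n"
    with DE obtain l where *: "v \<in> filt Z S n" "l \<in> L (n + i)"
      "l - (x ^^ i) v \<in> lower x Z S i (n + i)" by metis
    have z: "z \<in> Pol Ops" using \<open>z \<in> Z\<close> Z Pol_base by blast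
    have "z l - (x ^^ i) (z v) = z (l - (x ^^ i) v)"
      by (simp add: Pol_diff[OF z] Pol_commute[OF z pow])
    then show "z v \<in> D i (Suc n)"
      using DI[of "z v" "Suc n" "z l" i] filtrationD(3)[OF LZ \<open>z \<in> Z\<close>] *
        lower_op[OF x Z \<open>z \<in> Z\<close>] filt_op[OF \<open>z \<in> Z\<close>] by simp
  qed
  have D_Suc: "D i n \<subseteq> D (Suc i) n" for i n
  proof
    fix v assume "v \<in> D i n"
    with DE obtain l where *: "v \<in> filt Z S n" "l \<in> L (n + i)"
      "l - (x ^^ i) v \<in> lower x Z S i (n + i)" by metis
    have "x l - (x ^^ Suc i) v = x (l - (x ^^ i) v)"
      using Pol_diff[OF Pol_base[OF x]] by simp
    then show "v \<in> D (Suc i) n"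
      using DI[of v n "x l" "Suc i"] * filtrationD(3)[OF L, of x] lower_x[OF x Z] by simp
  qed
  have D_mono: "i \<le> j \<Longrightarrow> D i n \<subseteq> D j n" for i j n
    using lift_Suc_mono_le[of "\<lambda>i. D i n", OF D_Suc] .
  have D_filt: "D i n \<subseteq> filt Z S n" for i n by (auto simp: D_def)
  have "\<exists>k. \<forall>i. D i n \<subseteq> D k n" for n
  proof -
    obtain F where "finite F" "filt Z S n \<subseteq> span F"
      using filt_finite_dim[OF insert.hyps(1) Z assms(3)] by blast
    then show ?thesis
      using span_chain_stabilizes[of F "\<lambda>i. D i n"] D_filt D_Suc filtrationD(1)[OF D_filtration]
      by (meson subset_trans)
  qed
  then obtain k where k: "\<And>n i. D i n \<subseteq> D (k n) n" by metis
  define D' where "D' n = D (k n) n" for n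
  have "filtration Z D'"
  proof (rule filtrationI)
    show "subspace (D' n)" for n unfolding D'_def by (rule filtrationD(1)[OF D_filtration])
    show "v \<in> D' n \<Longrightarrow> v \<in> D' (Suc n)" for n v
      unfolding D'_def using filtrationD(2)[OF D_filtration] k by blast
    show "z \<in> Z \<Longrightarrow> v \<in> D' n \<Longrightarrow> z v \<in> D' (Suc n)" for n z v
      unfolding D'_def using filtrationD(3)[OF D_filtration] k by blast
  qed
  then obtain n' where n': "\<And>n. n \<ge> n' \<Longrightarrow> D' (Suc n) \<subseteq> step Z (D' n)"
    using insert.IH[OF Z, of D'] D_filt unfolding D'_def by blast
  \<comment> \<open>the chain \<open>D\<close> is stationary from \<open>i0\<close> on: first in degrees up to the bound \<open>n'\<close>, then in all\<close>
  define i0 where "i0 = Max (k ` {..n'})"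
  have D'_low: "D' n \<subseteq> D i0 n" if "n \<le> n'" for n
    unfolding D'_def using that D_mono[of "k n" i0 n] by (auto simp: i0_def)
  have D': "D' n \<subseteq> D i0 n" for n
  proof (cases "n \<le> n'")
    case False
    then have "n' \<le> n" by simp
    then show ?thesis
    proof (induction rule: dec_induct)
      case base
      then show ?case by (rule D'_low) simp
    next
      case (step n)
      have "D' (Suc n) \<subseteq> step Z (D i0 n)" using n'[OF step(1)] step_mono[OF step(3)] by blast
      then show ?case using D_filtration unfolding filtration_def by blast
    qed
  qed (rule D'_low)
  have "\<forall>i. \<exists>n0. \<forall>n\<ge>n0. D i (Suc n) \<subseteq> step Z (D i n)"
    using insert.IH[OF Z D_filtration D_filt] by blast
  then obtain h where h: "\<And>i n. n \<ge> h i \<Longrightarrow> D i (Suc n) \<subseteq> step Z (D i n)" by metis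
  define N where "N = Max (h ` {..i0})"
  \<comment> \<open>by induction on the \<open>x\<close>-degree, removing the leading term \<open>x\<^sup>i w\<close> with a vector of \<open>step (insert x Z) (L m)\<close>\<close>
  have main: "l \<in> step (insert x Z) (L m)"
    if m: "m \<ge> N + i0" and "l \<in> L (Suc m)" "l \<in> lower x Z S i (Suc m)" for m l i
    using that(2,3)
  proof (induction i arbitrary: l)
    case 0
    then have "l = 0" by (simp add: lower_def)
    then show ?case using subspace_0[OF subspace_step] by simp
  next
    case (Suc i)
    let ?ok = "\<lambda>w. \<exists>l'\<in>step (insert x Z) (L m). l' - (x ^^ i) w \<in> lower x Z S i (Suc m)"
    show ?case
    proof (cases "i \<le> Suc m")
      case False
      then show ?thesis using Suc lower_degenerate[OF x Z, of "Suc m" i] by simp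
    next
      case True
      obtain w where w: "w \<in> filt Z S (Suc m - i)" "l - (x ^^ i) w \<in> lower x Z S i (Suc m)"
        using lower_top[OF x Z Suc.prems(2) True] .
      have wD: "w \<in> D i (Suc m - i)"
        using DI[OF w(1), of l i] Suc.prems(1) w(2) True by simp
      have "?ok w"
      proof (cases "i \<le> i0")
        case True
        then have "h i \<le> N" by (auto simp: N_def)
        then have "h i \<le> m - i" "i \<le> m" using m True by auto
        then have "w \<in> step Z (D i (m - i))"
          using h wD by (auto simp: Suc_diff_le)
        moreover have "step Z (D i (m - i)) \<subseteq> {w. ?ok w}"
        proof (rule step_minimal)
          show "subspace {w. ?ok w}" by (rule subspace_lift[OF pow subspace_step subspace_lower])
        next
          show "D i (m - i) \<subseteq> {w. ?ok w}"
          proof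
            fix w assume "w \<in> D i (m - i)"
            with DE[OF this] \<open>i \<le> m\<close> obtain l' where "l' \<in> L m" "l' - (x ^^ i) w \<in> lower x Z S i m"
              by auto
            then show "w \<in> {w. ?ok w}" using step_base lower_Suc_base by blast
          qed
        next
          fix z w assume z: "z \<in> Z" and "w \<in> D i (m - i)"
          with DE[of w i "m - i"] \<open>i \<le> m\<close>
          obtain l' where l': "l' \<in> L m" "l' - (x ^^ i) w \<in> lower x Z S i m" by auto
          have zP: "z \<in> Pol Ops" using z Z Pol_base by blast
          have "z l' - (x ^^ i) (z w) = z (l' - (x ^^ i) w)"
            by (simp add: Pol_diff[OF zP] Pol_commute[OF zP pow])
          then have "z l' - (x ^^ i) (z w) \<in> lower x Z S i (Suc m)"
            using lower_op[OF x Z z l'(2)] by simp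
          moreover have "z l' \<in> step (insert x Z) (L m)" using z l'(1) by (intro step_op) auto
          ultimately show "z w \<in> {w. ?ok w}" by blast
        qed
        ultimately show ?thesis by blast
      next
        case False
        then obtain j where j: "i = Suc j" "i0 \<le> j" by (cases i) auto
        have "w \<in> D i0 (m - j)"
          using wD j(1) subsetD[OF k] subsetD[OF D'[unfolded D'_def]] by simp
        then have "w \<in> D j (m - j)" using D_mono[OF j(2)] by blast
        with DE[OF this] j True obtain l' where "l' \<in> L m" "l' - (x ^^ j) w \<in> lower x Z S j m" by auto
        then have "x l' \<in> step (insert x Z) (L m)" "x l' - (x ^^ i) w \<in> lower x Z S i (Suc m)"
          using lower_x[OF x Z, of "l' - (x ^^ j) w" S j m] Pol_diff[OF Pol_base[OF x]] j
          by (auto intro: step_op)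
        then show ?thesis by blast
      qed
      then obtain l' where l': "l' \<in> step (insert x Z) (L m)" "l' - (x ^^ i) w \<in> lower x Z S i (Suc m)"
        by blast
      have "l - l' = (l - (x ^^ i) w) - (l' - (x ^^ i) w)" by simp
      then have "l - l' \<in> lower x Z S i (Suc m)"
        using subspace_diff[OF subspace_lower w(2) l'(2)] by simp
      moreover have "l - l' \<in> L (Suc m)"
        using subspace_diff[OF filtrationD(1)[OF L] Suc.prems(1)] l'(1) L
        unfolding filtration_def by blast
      ultimately have "l - l' \<in> step (insert x Z) (L m)" by (intro Suc.IH)
      from subspace_add[OF subspace_step this l'(1)] show ?thesis by simp
    qed
  qed
  show ?case
  proof (intro exI[of _ "N + i0"] allI impI subsetI)
    fix m l assume "N + i0 \<le> m" "l \<in> L (Suc m)"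
    then show "l \<in> step (insert x Z) (L m)"
      using main insert.prems(3) filt_insert_lower[OF x Z] by blast
  qed
qed

section \<open>Artin-Rees comparison and chain conditions\<close>

text \<open>
  The filtration induced on \<open>N\<close> eventually grows by applying operators only, so a basis of one
  sufficiently late term generates all of it, with no shift of degree.
\<close>

lemma submodule_filt_generators:
  assumes "finite Z" "Z \<subseteq> Ops" "finite S" "submodule Z N"
  obtains G where "finite G" "G \<subseteq> N" "G \<subseteq> gen Z S" "\<And>n. N \<inter> filt Z S n \<subseteq> filt Z G n"
proof -
  define L where "L n = N \<inter> filt Z S n" for n
  have L: "filtration Z L"
  proof (rule filtrationI)
    show "subspace (L n)" for n
      using assms(4) subspace_inter[OF _ subspace_filt] by (simp add: L_def submodule_def)
    show "v \<in> L n \<Longrightarrow> v \<in> L (Suc n)" for n v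
      using filt_mono[of n "Suc n" v Z S] by (simp add: L_def)
    show "z \<in> Z \<Longrightarrow> v \<in> L n \<Longrightarrow> z v \<in> L (Suc n)" for n z v
      using assms(4) filt_op[of z Z v S n] by (simp add: L_def submodule_def)
  qed
  obtain k where k: "\<And>n. n \<ge> k \<Longrightarrow> L (Suc n) \<subseteq> step Z (L n)"
    using filtration_eventually_step[OF assms(1,2,3) L] by (auto simp: L_def)
  obtain G where G: "G \<subseteq> L k" "independent G" "L k \<subseteq> span G"
    using maximal_independent_subset by blast
  obtain F where F: "finite F" "filt Z S k \<subseteq> span F"
    using filt_finite_dim[OF assms(1,2,3)] .
  have "finite G"
    using independent_span_bound[OF F(1) G(2)] F(2) G(1) by (auto simp: L_def)
  have low: "L n \<subseteq> filt Z G n" if "n \<le> k" for n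
    using filtration_mono[OF L that] G(3) filt_mono[of 0 n _ Z G] by auto
  have "L n \<subseteq> filt Z G n" for n
  proof (cases "n \<le> k")
    case False
    then have "k \<le> n" by simp
    then show ?thesis
    proof (induction rule: dec_induct)
      case base
      then show ?case by (rule low) simp
    next
      case (step n)
      then show ?case using k[OF step(1)] step_mono[OF step(3), of Z Z] by (auto simp: filt.simps(2))
    qed
  qed (rule low)
  moreover have "G \<subseteq> N" "G \<subseteq> gen Z S" using G(1) by (auto simp: L_def gen_def)
  ultimately show ?thesis using that \<open>finite G\<close> by (simp add: L_def)
qed

text \<open>
  Finite generators of the relevant part of \<open>gen Z R\<close>, chosen as above, have bounded degree over
  \<open>R\<close>; the bound is the constant. The submodule \<open>N\<close> allows comparison in a quotient, and \<open>N = {0}\<close>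
  is the plain statement.
\<close>

lemma filt_comparison:
  assumes "finite Z" "Z \<subseteq> Ops" "finite S" "submodule Z N" "N \<subseteq> R"
  obtains c where "\<And>n v. v \<in> gen Z R \<Longrightarrow> v \<in> filt Z (S \<union> N) n \<Longrightarrow> v \<in> filt Z R (n + c)"
proof -
  obtain G where G: "finite G" "G \<subseteq> gen Z R" "\<And>n. gen Z R \<inter> filt Z S n \<subseteq> filt Z G n"
    using submodule_filt_generators[OF assms(1-3) submodule_gen] by metis
  obtain c where c: "G \<subseteq> filt Z R c" using finite_subset_gen[OF G(1,2)] .
  have "v \<in> filt Z R (n + c)" if v: "v \<in> gen Z R" "v \<in> filt Z (S \<union> N) n" for n v
  proof -
    obtain w where w: "w \<in> N" "v - w \<in> filt Z S n"
      using filt_Un_submodule[OF assms(2,4) v(2)] .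
    have wR: "w \<in> filt Z R m" for m using w(1) assms(5) filt_base by blast
    have "v - w \<in> gen Z R"
      using submodule_gen v(1) filtI_gen[OF wR[of 0]] by (simp add: submodule_def subspace_diff)
    then have "v - w \<in> filt Z R (n + c)"
      using w(2) G(3) filt_trans[OF c subset_refl] by blast
    from subspace_add[OF subspace_filt this wR] show ?thesis by simp
  qed
  then show ?thesis using that by blast
qed

text \<open>
  The ascending chain condition, in the form used for Noetherian induction: the finitely many
  generators of the union of a chain lie in one of its members.
\<close>

lemma submodules_have_maximal:
  assumes "finite Z" "Z \<subseteq> Ops" "finite S" "\<F> \<noteq> {}"
    "\<And>N. N \<in> \<F> \<Longrightarrow> submodule Z N" "\<And>N. N \<in> \<F> \<Longrightarrow> N \<subseteq> gen Z S"
  obtains M where "M \<in> \<F>" "\<And>N. N \<in> \<F> \<Longrightarrow> M \<subseteq> N \<Longrightarrow> N = M"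
proof -
  have "\<exists>M\<in>\<F>. \<forall>X\<in>\<F>. M \<subseteq> X \<longrightarrow> X = M"
  proof (rule subset_Zorn_nonempty[OF assms(4)])
    fix C assume C: "C \<noteq> {}" "subset.chain \<F> C"
    then have CF: "\<And>N. N \<in> C \<Longrightarrow> N \<in> \<F>" by (auto simp: subset.chain_def)
    have tot: "A \<subseteq> B \<or> B \<subseteq> A" if "A \<in> C" "B \<in> C" for A B
      using C(2) that by (meson subset_chain_def)
    have sub: "subspace N" if "N \<in> C" for N using assms(5) CF that by (simp add: submodule_def)
    have "submodule Z (\<Union>C)"
      unfolding submodule_def subspace_def
    proof (intro conjI ballI allI)
      show "0 \<in> \<Union>C" using C(1) sub subspace_0 by blast
    next
      fix v w assume "v \<in> \<Union>C" "w \<in> \<Union>C"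
      then obtain N where "N \<in> C" "v \<in> N" "w \<in> N" using tot by blast
      then show "v + w \<in> \<Union>C" using sub subspace_add by blast
    next
      fix c v assume "v \<in> \<Union>C"
      then obtain N where "N \<in> C" "v \<in> N" by blast
      then show "c *s v \<in> \<Union>C" using sub[of N] subspace_scale[of N v c] by blast
    next
      fix z v assume "z \<in> Z" "v \<in> \<Union>C"
      then show "z v \<in> \<Union>C" using assms(5) CF unfolding submodule_def by blast
    qed
    then obtain G where G: "finite G" "G \<subseteq> \<Union>C" "\<And>n. \<Union>C \<inter> filt Z S n \<subseteq> filt Z G n"
      using submodule_filt_generators[OF assms(1-3)] by metis
    obtain N where N: "N \<in> C" "G \<subseteq> N"
      using finite_subset_Union_chain[OF G(1,2) C] by blast
    have "\<Union>C \<subseteq> gen Z G"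
    proof
      fix v assume v: "v \<in> \<Union>C"
      then have "v \<in> gen Z S" using assms(6) CF by blast
      then obtain n where "v \<in> filt Z S n" by (auto simp: gen_def)
      then show "v \<in> gen Z G" using v G(3) filtI_gen by blast
    qed
    also have "\<dots> \<subseteq> N" using gen_minimal[OF assms(5)[OF CF[OF N(1)]] N(2)] .
    finally have "\<Union>C = N" using N(1) by blast
    then show "\<Union>C \<in> \<F>" using CF N(1) by simp
  qed
  then show ?thesis using that by blast
qed

text \<open>
  For \<open>u \<notin> N\<close>: the annihilator of \<open>u\<close> modulo \<open>N\<close> is a prime ideal; equivalently, a polynomial that does not
  kill \<open>u\<close> modulo \<open>N\<close> acts injectively on the quotient of \<open>gen Z ({u} \<union> N)\<close> by \<open>N\<close>.
\<close>

definition prime_modulo :: "('v \<Rightarrow> 'v) set \<Rightarrow> 'v \<Rightarrow> 'v set \<Rightarrow> bool" where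
  "prime_modulo Z u N \<longleftrightarrow>
     (\<forall>p\<in>Pol Z. \<forall>v\<in>gen Z ({u} \<union> N). p u \<notin> N \<longrightarrow> p v \<in> N \<longrightarrow> v \<in> N)"

text \<open>
  The usual argument takes a maximal annihilator. To need chain conditions only for vectors and not
  for ideals of operators, the maximal element is chosen among the submodules
  \<open>{v \<in> gen Z {u}. p v \<in> N}\<close>, where \<open>p\<close> ranges over the polynomials that do not kill \<open>u\<close>. If \<open>q\<close>
  does not kill \<open>p u\<close>, then \<open>q \<circ> p\<close> defines a submodule that contains the one of \<open>p\<close>, hence equals it,
  and so \<open>q (r (p u)) \<in> N\<close> forces \<open>r (p u) \<in> N\<close>.
\<close>

lemma exists_prime_modulo:
  assumes "finite Z" "Z \<subseteq> Ops" "submodule Z N" "u \<notin> N"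
  obtains p where "p \<in> Pol Z" "p u \<notin> N" "prime_modulo Z (p u) N"
proof -
  note PolOps = Pol_mono[OF _ assms(2)]
  let ?K = "\<lambda>p. gen Z {u} \<inter> {v. p v \<in> N}"
  let ?F = "?K ` {p \<in> Pol Z. p u \<notin> N}"
  have "?K (\<lambda>v. v) \<in> ?F" using assms(4) Pol_id by (intro imageI) simp
  then have "?F \<noteq> {}" by blast
  moreover have "submodule Z K" if "K \<in> ?F" for K
    using that submodule_Int[OF submodule_gen submodule_vimage[OF PolOps assms(2,3)]] by auto
  ultimately obtain M where "M \<in> ?F" "\<And>K. K \<in> ?F \<Longrightarrow> M \<subseteq> K \<Longrightarrow> K = M"
    using submodules_have_maximal[OF assms(1,2), of "{u}" ?F] by blast
  then obtain p where p: "p \<in> Pol Z" "p u \<notin> N"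
    and max: "\<And>q. q \<in> Pol Z \<Longrightarrow> q u \<notin> N \<Longrightarrow> ?K p \<subseteq> ?K q \<Longrightarrow> ?K q = ?K p"
    by auto
  have "v \<in> N" if q: "q \<in> Pol Z" "q (p u) \<notin> N" and v: "v \<in> gen Z ({p u} \<union> N)" "q v \<in> N" for q v
  proof -
    obtain n where "v \<in> filt Z ({p u} \<union> N) n" using v(1) by (auto simp: gen_def)
    then obtain w where w: "w \<in> N" "v - w \<in> filt Z {p u} n"
      using filt_Un_submodule[OF assms(2,3)] by blast
    then obtain r where r: "r \<in> Pol Z" "v - w = r (p u)"
      using gen_singleton filtI_gen by metis
    have qp: "(\<lambda>v. q (p v)) \<in> Pol Z" by (rule Pol_comp[OF q(1) p(1)])
    have "?K p \<subseteq> ?K (\<lambda>v. q (p v))" using submodule_Pol[OF assms(3) q(1)] by auto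
    then have eq: "?K (\<lambda>v. q (p v)) = ?K p" using max[OF qp q(2)] by simp
    have rp: "r (p u) = p (r u)" using Pol_commute[OF PolOps PolOps] r(1) p(1) by blast
    have "q (v - w) \<in> N"
      using v(2) submodule_Pol[OF assms(3) q(1) w(1)] assms(3) Pol_diff[OF PolOps[OF q(1)]]
      by (simp add: submodule_def subspace_diff)
    then have "r u \<in> ?K (\<lambda>v. q (p v))"
      using r rp submodule_Pol[OF submodule_gen r(1)] gen_base[of u "{u}"] by simp
    then have "v - w \<in> N" using eq r rp by auto
    then show "v \<in> N" using w(1) assms(3) subspace_add[of N "v - w" w] by (simp add: submodule_def)
  qed
  then have "prime_modulo Z (p u) N" unfolding prime_modulo_def by blast
  then show ?thesis using that p by blast
qed

lemma filt_image:
  assumes "p \<in> Pol Ops" "Z \<subseteq> Ops"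
  shows "filt Z (p ` S) n \<subseteq> p ` filt Z S n"
proof (rule filt_least)
  show "filtration Z (\<lambda>n. p ` filt Z S n)"
  proof (rule filtrationI)
    show "subspace (p ` filt Z S n)" for n by (rule subspace_image_Pol[OF assms(1) subspace_filt])
    show "v \<in> p ` filt Z S n \<Longrightarrow> v \<in> p ` filt Z S (Suc n)" for n v
      using filt_mono[of n "Suc n" _ Z S] by auto
    show "z v \<in> p ` filt Z S (Suc n)" if z: "z \<in> Z" and v: "v \<in> p ` filt Z S n" for z n v
    proof -
      obtain w where w: "w \<in> filt Z S n" "v = p w" using v by blast
      have "z v = p (z w)" using w(2) Pol_commute_Ops[OF assms(1)] z assms(2) by auto
      then show ?thesis using filt_op[OF z w(1)] by blast
    qed
  qed
  show "p ` S \<subseteq> p ` filt Z S 0" by (auto simp: span_base)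
qed

section \<open>Adjoining one operator\<close>

text \<open>
  With \<open>M\<close> the quotient of the \<open>Z\<close>-module generated by \<open>S \<union> N\<close> by \<open>N\<close>: every finitely generated
  \<open>Y\<close>-submodule of \<open>M\<close> is undistorted. The summand \<open>+ t\<close> covers degree \<open>0\<close>, where a vector in
  the span of \<open>S\<close> may already need words of positive length over \<open>T\<close>.
\<close>

definition undistorted_modulo ::
    "('v \<Rightarrow> 'v) set \<Rightarrow> ('v \<Rightarrow> 'v) set \<Rightarrow> 'v set \<Rightarrow> 'v set \<Rightarrow> bool" where
  "undistorted_modulo Y Z S N \<longleftrightarrow>
     (\<forall>T. finite T \<longrightarrow> T \<subseteq> gen Z (S \<union> N) \<longrightarrow>
       (\<exists>t. \<forall>n. gen Y (T \<union> N) \<inter> filt Z (S \<union> N) n \<subseteq> filt Y (T \<union> N) (t * n + t)))"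

text \<open>
  The vectors \<open>a t\<close> with \<open>t \<in> T\<close> generate a \<open>Y\<close>-module containing \<open>a v\<close>, which by comparison has degree
  \<open>m + c\<close> there, so \<open>a v\<close> agrees modulo \<open>N\<close> with \<open>a v'\<close> for some \<open>v'\<close> of degree \<open>m + c\<close> over \<open>T\<close>.
  Primality cancels \<open>a\<close>.
\<close>

lemma filt_division:
  assumes "finite Y" "Y \<subseteq> Z" "Z \<subseteq> Ops" "submodule Z N" "prime_modulo Z u N"
    "finite T" "T \<subseteq> gen Z ({u} \<union> N)" "a \<in> Pol Y" "a u \<notin> N"
  obtains c where "\<And>m v. v \<in> gen Y (T \<union> N) \<Longrightarrow> a v \<in> filt Y (T \<union> N) m \<Longrightarrow> v \<in> filt Y (T \<union> N) (m + c)"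
proof -
  have Y: "Y \<subseteq> Ops" using assms(2,3) by blast
  have a: "a \<in> Pol Z" "a \<in> Pol Ops" using Pol_mono[OF assms(8)] assms(2) Y by auto
  note NY = submodule_subset[OF assms(4,2)]
  let ?R = "a ` T \<union> N"
  obtain c where c: "\<And>n v. v \<in> gen Y ?R \<Longrightarrow> v \<in> filt Y (T \<union> N) n \<Longrightarrow> v \<in> filt Y ?R (n + c)"
    using filt_comparison[OF assms(1) Y assms(6) NY, of ?R] by blast
  have TN: "T \<union> N \<subseteq> gen Z ({u} \<union> N)" using assms(7) gen_base[of _ "{u} \<union> N"] by blast
  have sub: "subspace N" "subspace (gen Z ({u} \<union> N))"
    using assms(4) submodule_gen by (auto simp: submodule_def)
  have "v \<in> filt Y (T \<union> N) (m + c)"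
    if v: "v \<in> gen Y (T \<union> N)" "a v \<in> filt Y (T \<union> N) m" for m v
  proof -
    have "gen Y (T \<union> N) \<subseteq> {v. a v \<in> gen Y ?R}"
      using submodule_Pol[OF NY assms(8)]
      by (intro gen_minimal submodule_vimage[OF a(2) Y submodule_gen]) (auto intro: gen_base)
    then have "a v \<in> filt Y ?R (m + c)" using c v by blast
    then obtain w where w: "w \<in> N" "a v - w \<in> filt Y (a ` T) (m + c)"
      using filt_Un_submodule[OF Y NY] by blast
    then obtain v' where v': "v' \<in> filt Y T (m + c)" "a v - w = a v'"
      using filt_image[OF a(2) Y] by blast
    have v'1: "v' \<in> filt Y (T \<union> N) (m + c)" using v'(1) filt_mono_gens[of T "T \<union> N" Y Y] by blast
    have "v - v' \<in> gen Z ({u} \<union> N)"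
      using subspace_diff[OF sub(2)] gen_mono[OF TN assms(2)] v(1) filtI_gen[OF v'1] by blast
    moreover have "a (v - v') \<in> N"
      using v'(2) w(1) by (simp add: Pol_diff[OF a(2)] algebra_simps)
    ultimately have "v - v' \<in> N" using assms(5,9) a(1) unfolding prime_modulo_def by blast
    then have "v - v' \<in> filt Y (T \<union> N) (m + c)" using filt_base by blast
    from subspace_add[OF subspace_filt this v'1] show ?thesis by simp
  qed
  then show ?thesis using that by blast
qed

lemma lower_subset_filt_powers:
  assumes "x \<in> Ops" "Y \<subseteq> Ops"
  shows "lower x Y {u} i m \<subseteq> filt Y ((\<lambda>j. (x ^^ j) u) ` {..<i}) m"
proof (rule lower_minimal[OF subspace_filt])
  fix j v assume j: "j < i" "j \<le> m" and v: "v \<in> filt Y {u} (m - j)"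
  let ?S = "(\<lambda>j. (x ^^ j) u) ` {..<i}"
  have "(x ^^ j) v \<in> filt Y ?S (m - j)"
    using j(1) by (intro filt_Pol_commute[OF Ops_pow[OF assms(1)] assms(2) filtration_filt _ v])
      (auto simp: span_base)
  then show "(x ^^ j) v \<in> filt Y ?S m" by (rule filt_mono[rotated]) simp
qed

text \<open>
  Let \<open>D\<close> be the filtration generated by \<open>u, \<dots>, x\<^sup>d\<^sup>-\<^sup>1 u\<close> modulo \<open>N\<close>. The relation for \<open>a x\<^sup>d u\<close> makes
  \<open>a x\<close> map \<open>D\<close> to itself with a bounded shift \<open>k\<close>, so \<open>a\<^sup>n\<close> brings degree \<open>n\<close> over \<open>Z\<close> into degree
  \<open>n (k + 1)\<close> of \<open>D\<close>. Comparing \<open>D\<close> with \<open>T\<close> and dividing \<open>n\<close> times by \<open>a\<close> returns to the original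
  vector at linear cost.
\<close>

lemma undistorted_modulo_prime_algebraic:
  assumes "finite Y" "Y \<subseteq> Ops" "x \<in> Ops" "submodule (insert x Y) N" "prime_modulo (insert x Y) u N"
    and a: "a \<in> Pol Y" "a u \<notin> N" "a ((x ^^ d) u) \<in> gen Y ((\<lambda>j. (x ^^ j) u) ` {..<d} \<union> N)"
  shows "undistorted_modulo Y (insert x Y) {u} N"
  unfolding undistorted_modulo_def
proof (intro allI impI)
  let ?Z = "insert x Y"
  fix T assume T: "finite T" "T \<subseteq> gen ?Z ({u} \<union> N)"
  have Z: "?Z \<subseteq> Ops" using assms(2,3) by simp
  note NY = submodule_subset[OF assms(4) subset_insertI]
  let ?S = "(\<lambda>j. (x ^^ j) u) ` {..<d}"
  define D where "D = filt Y (?S \<union> N)"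
  have D: "filtration Y D" unfolding D_def by (rule filtration_filt)
  have D_base: "v \<in> ?S \<union> N \<Longrightarrow> v \<in> D n" for v n unfolding D_def by (rule filt_base)
  have aO: "a \<in> Pol Ops" using Pol_mono[OF a(1) assms(2)] .
  have xO: "x \<in> Pol Ops" using Pol_base[OF assms(3)] .
  have axO: "(\<lambda>v. a (x v)) \<in> Pol Ops" by (rule Pol_comp[OF aO xO])
  have apO: "(a ^^ n) \<in> Pol Ops" for n by (rule Pol_funpow[OF aO])
  obtain k0 where k0: "a ((x ^^ d) u) \<in> D k0" using a(3) by (auto simp: gen_def D_def)
  obtain ka where ka: "\<And>L n v. filtration Y L \<Longrightarrow> v \<in> L n \<Longrightarrow> a v \<in> L (n + ka)"
    using Pol_degree[OF a(1)] by auto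
  define k where "k = k0 + ka"
  have "d > 0"
  proof (rule ccontr)
    assume "\<not> d > 0"
    then have "a u \<in> gen Y N" using a(3) by simp
    then show False using gen_minimal[OF NY subset_refl] a(2) by blast
  qed
  have ax: "a (x v) \<in> D (m + k)" if "v \<in> D m" for v m
  proof (rule filt_Pol_commute[OF axO assms(2) filtration_shift[OF D], of "?S \<union> N"])
    show "v \<in> filt Y (?S \<union> N) m" using that by (simp add: D_def)
    show "(\<lambda>v. a (x v)) ` (?S \<union> N) \<subseteq> D (0 + k)"
    proof (intro image_subsetI)
      fix v assume "v \<in> ?S \<union> N"
      then consider j where "Suc j < d" "v = (x ^^ j) u" | "x v = (x ^^ d) u" | "v \<in> N"
      proof (cases "v \<in> N")
        case False
        then obtain j where j: "j < d" "v = (x ^^ j) u" using \<open>v \<in> ?S \<union> N\<close> by blast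
        then have "Suc j < d \<or> Suc j = d" by auto
        then show ?thesis using j(2) that(1,2) by auto
      qed (rule that(3))
      then show "a (x v) \<in> D (0 + k)"
      proof cases
        case 1
        have "(x ^^ Suc j) u \<in> ?S" using 1(1) by blast
        then have "x v \<in> D 0" using D_base[of "(x ^^ Suc j) u"] 1(2) by simp
        from ka[OF D this] show ?thesis by (rule filtration_mono[OF D, rotated]) (simp add: k_def)
      next
        case 2
        then show ?thesis using filtration_mono[OF D, of k0 k] k0 by (simp add: k_def)
      next
        case 3
        then have "x v \<in> N" using assms(4) by (simp add: submodule_def)
        then have "a (x v) \<in> N" using submodule_Pol[OF NY a(1)] by blast
        then show ?thesis using D_base by blast
      qed
    qed
  qed
  have filtQ: "filtration ?Z (\<lambda>n. {v. (a ^^ n) v \<in> D (n * Suc k)})"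
  proof (rule filtrationI)
    fix n
    show "subspace {v. (a ^^ n) v \<in> D (n * Suc k)}"
      by (rule subspace_vimage_Pol[OF apO filtrationD(1)[OF D]])
    {
      fix v assume "v \<in> {v. (a ^^ n) v \<in> D (n * Suc k)}"
      then have v: "(a ^^ n) v \<in> D (n * Suc k)" by simp
      have "(a ^^ Suc n) v \<in> D (n * Suc k + ka)" using ka[OF D v] by simp
      then have "(a ^^ Suc n) v \<in> D (Suc n * Suc k)"
        by (rule filtration_mono[OF D, rotated]) (simp add: k_def)
      then show "v \<in> {v. (a ^^ Suc n) v \<in> D (Suc n * Suc k)}" by simp
      fix z assume z: "z \<in> ?Z"
      have eq: "(a ^^ Suc n) (z v) = a (z ((a ^^ n) v))"
        using Pol_commute_Ops[OF apO] z Z by auto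
      have "a (z ((a ^^ n) v)) \<in> D (Suc n * Suc k)"
      proof (cases "z \<in> Y")
        case True
        from ka[OF D filtrationD(3)[OF D True v]]
        show ?thesis by (rule filtration_mono[OF D, rotated]) (simp add: k_def)
      next
        case False
        then have "z = x" using z by simp
        with ax[OF v] show ?thesis using filtration_mono[OF D, of "n * Suc k + k"] by simp
      qed
      then show "z v \<in> {v. (a ^^ Suc n) v \<in> D (Suc n * Suc k)}" using eq by simp
    }
  qed
  have "u \<in> ?S" using \<open>d > 0\<close> by (force intro: image_eqI[of _ _ 0])
  then have "{u} \<union> N \<subseteq> {v. (a ^^ 0) v \<in> D (0 * Suc k)}" using D_base by auto
  from filt_least[OF filtQ this]
  have clear: "(a ^^ n) v \<in> D (n * Suc k)" if "v \<in> filt ?Z ({u} \<union> N) n" for v n using that by blast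
  obtain c0 where c0: "\<And>m v. v \<in> gen Y (T \<union> N) \<Longrightarrow> v \<in> D m \<Longrightarrow> v \<in> filt Y (T \<union> N) (m + c0)"
    unfolding D_def using filt_comparison[OF assms(1,2) _ NY, of ?S "T \<union> N"] by blast
  obtain c where c: "\<And>m v. v \<in> gen Y (T \<union> N) \<Longrightarrow> a v \<in> filt Y (T \<union> N) m \<Longrightarrow> v \<in> filt Y (T \<union> N) (m + c)"
    using filt_division[OF assms(1) subset_insertI Z assms(4,5) T a(1,2)] by blast
  have apG: "(a ^^ n) v \<in> gen Y (T \<union> N)" if "v \<in> gen Y (T \<union> N)" for n v
    by (rule submodule_Pol[OF submodule_gen Pol_funpow[OF a(1)] that])
  have divide: "v \<in> filt Y (T \<union> N) (m + n * c)"
    if "v \<in> gen Y (T \<union> N)" "(a ^^ n) v \<in> filt Y (T \<union> N) m" for n m v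
    using that(2)
  proof (induction n arbitrary: m)
    case (Suc n)
    then have "(a ^^ n) v \<in> filt Y (T \<union> N) (m + c)" using c[OF apG[OF that(1)]] by simp
    from Suc.IH[OF this] show ?case by (simp add: add.assoc)
  qed simp
  show "\<exists>t. \<forall>n. gen Y (T \<union> N) \<inter> filt ?Z ({u} \<union> N) n \<subseteq> filt Y (T \<union> N) (t * n + t)"
  proof (intro exI[of _ "Suc k + c0 + c"] allI subsetI)
    fix n l assume "l \<in> gen Y (T \<union> N) \<inter> filt ?Z ({u} \<union> N) n"
    then have l: "l \<in> gen Y (T \<union> N)" "(a ^^ n) l \<in> D (n * Suc k)" using clear by auto
    have "l \<in> filt Y (T \<union> N) (n * Suc k + c0 + n * c)"
      by (rule divide[OF l(1) c0[OF apG[OF l(1)] l(2)]])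
    then show "l \<in> filt Y (T \<union> N) ((Suc k + c0 + c) * n + (Suc k + c0 + c))"
      by (rule filt_mono[rotated]) (simp add: algebra_simps)
  qed
qed

text \<open>
  The assumption \<open>tr\<close> says that the \<open>Y\<close>-modules generated by the \<open>x\<^sup>i u\<close> are independent modulo \<open>N\<close>.
  Since \<open>T\<close> involves only powers of \<open>x\<close> below some \<open>d\<close>, so does the whole \<open>Y\<close>-module it generates,
  and all terms of higher \<open>x\<close>-degree in an expression of one of its vectors vanish modulo \<open>N\<close>.
\<close>

lemma undistorted_modulo_prime_transcendental:
  assumes "finite Y" "Y \<subseteq> Ops" "x \<in> Ops" "submodule (insert x Y) N"
    and tr: "\<And>a d. a \<in> Pol Y \<Longrightarrow> a ((x ^^ d) u) \<in> gen Y ((\<lambda>j. (x ^^ j) u) ` {..<d} \<union> N) \<Longrightarrow> a u \<in> N"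
  shows "undistorted_modulo Y (insert x Y) {u} N"
  unfolding undistorted_modulo_def
proof (intro allI impI)
  let ?Z = "insert x Y"
  fix T assume T: "finite T" "T \<subseteq> gen ?Z ({u} \<union> N)"
  have Z: "?Z \<subseteq> Ops" using assms(2,3) by simp
  note NY = submodule_subset[OF assms(4) subset_insertI]
  define S where "S d = (\<lambda>j. (x ^^ j) u) ` {..<d}" for d
  note low = lower_subset_filt_powers[OF assms(3,2), of u, folded S_def]
  have S_mono: "i \<le> j \<Longrightarrow> S i \<subseteq> S j" for i j by (auto simp: S_def)
  have decomp: "\<exists>w\<in>N. v - w \<in> lower x Y {u} (Suc n) n" if "v \<in> filt ?Z ({u} \<union> N) n" for v n
    using filt_Un_submodule[OF Z assms(4) that] subsetD[OF filt_insert_lower[OF assms(3,2)]] by metis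
  obtain m where m: "T \<subseteq> filt ?Z ({u} \<union> N) m" using finite_subset_gen[OF T] .
  define d where "d = Suc m"
  have N_gen: "w \<in> N \<Longrightarrow> w \<in> filt Y (S i \<union> N) n" for w i n by (auto intro: filt_base)
  have TS: "gen Y (T \<union> N) \<subseteq> gen Y (S d \<union> N)"
  proof (intro gen_mono Un_least)
    show "T \<subseteq> gen Y (S d \<union> N)"
    proof
      fix v assume "v \<in> T"
      then obtain w where w: "w \<in> N" "v - w \<in> lower x Y {u} d m" using m decomp d_def by blast
      then have "v - w \<in> filt Y (S d \<union> N) m"
        using low filt_mono_gens[of "S d" "S d \<union> N" Y Y m] by blast
      from subspace_add[OF subspace_filt this N_gen[OF w(1)]]
      show "v \<in> gen Y (S d \<union> N)" by (auto intro: filtI_gen)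
    qed
  qed (auto intro: gen_base)
  have sub: "subspace (gen Y R)" for R using submodule_gen by (auto simp: submodule_def)
  \<comment> \<open>by induction on the \<open>x\<close>-degree; a leading term \<open>x\<^sup>i w\<close> with \<open>i \<ge> d\<close> is in \<open>N\<close> by independence\<close>
  have main: "v \<in> filt Y (S d \<union> N) n"
    if "v \<in> lower x Y {u} i n" "v \<in> gen Y (S d \<union> N)" for v i n
    using that
  proof (induction i arbitrary: v)
    case 0
    then have "v = 0" by (simp add: lower_def)
    then show ?case using subspace_0[OF subspace_filt] by simp
  next
    case (Suc i)
    consider "Suc i \<le> d" | "n < i" | "d \<le> i" "i \<le> n" by linarith
    then show ?case
    proof cases
      case 1
      then show ?thesis
        using Suc.prems(1) low filt_mono_gens[of "S (Suc i)" "S d \<union> N" Y Y n] S_mono by blast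
    next
      case 2
      then show ?thesis using Suc lower_degenerate[OF assms(3,2)] by simp
    next
      case 3
      obtain w where w: "w \<in> filt Y {u} (n - i)" "v - (x ^^ i) w \<in> lower x Y {u} i n"
        using lower_top[OF assms(3,2) Suc.prems(1) 3(2)] .
      obtain b where b: "b \<in> Pol Y" "w = b u" using gen_singleton[OF filtI_gen[OF w(1)]] .
      have "(x ^^ i) w = b ((x ^^ i) u)"
        using b Pol_commute[OF Ops_pow[OF assms(3)] Pol_mono[OF b(1) assms(2)]] by simp
      moreover have "(x ^^ i) w \<in> gen Y (S i \<union> N)"
      proof -
        have "v \<in> gen Y (S i \<union> N)"
          using Suc.prems(2) gen_mono[of "S d \<union> N" Y "S i \<union> N" Y] S_mono[OF 3(1)]
          by (blast intro: gen_base)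
        moreover have "v - (x ^^ i) w \<in> gen Y (S i \<union> N)"
          using w(2) low filt_mono_gens[of "S i" "S i \<union> N" Y Y n] filtI_gen by blast
        ultimately have "v - (v - (x ^^ i) w) \<in> gen Y (S i \<union> N)" by (rule subspace_diff[OF sub])
        then show ?thesis by simp
      qed
      ultimately have "w \<in> N" using tr[OF b(1), of i] b(2) by (simp add: S_def)
      then have xw: "(x ^^ i) w \<in> N"
        using submodule_Pol[OF assms(4) Pol_funpow[OF Pol_base]] by blast
      then have "v - (x ^^ i) w \<in> gen Y (S d \<union> N)"
        using subspace_diff[OF sub Suc.prems(2)] by (blast intro: gen_base)
      from subspace_add[OF subspace_filt Suc.IH[OF w(2) this] N_gen[OF xw]] show ?thesis by simp
    qed
  qed
  have "finite (S d)" by (simp add: S_def)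
  then obtain c where c: "\<And>m v. v \<in> gen Y (T \<union> N) \<Longrightarrow> v \<in> filt Y (S d \<union> N) m \<Longrightarrow> v \<in> filt Y (T \<union> N) (m + c)"
    using filt_comparison[OF assms(1,2) _ NY, of "S d" "T \<union> N"] by blast
  show "\<exists>t. \<forall>n. gen Y (T \<union> N) \<inter> filt ?Z ({u} \<union> N) n \<subseteq> filt Y (T \<union> N) (t * n + t)"
  proof (intro exI[of _ "Suc c"] allI subsetI)
    fix n l assume l: "l \<in> gen Y (T \<union> N) \<inter> filt ?Z ({u} \<union> N) n"
    then obtain w where w: "w \<in> N" "l - w \<in> lower x Y {u} (Suc n) n" using decomp by blast
    have "l - w \<in> gen Y (S d \<union> N)"
      using l TS w(1) by (blast intro: gen_base subspace_diff[OF sub])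
    from subspace_add[OF subspace_filt main[OF w(2) this] N_gen[OF w(1)]]
    have "l \<in> filt Y (T \<union> N) (n + c)" using c l by simp
    then show "l \<in> filt Y (T \<union> N) (Suc c * n + Suc c)" by (rule filt_mono[rotated]) simp
  qed
qed

text \<open>
  A vector \<open>l\<close> of the submodule is first approximated modulo \<open>N'\<close>, at linear cost. The error \<open>w\<close> is in \<open>N'\<close> and
  has linearly bounded degree over \<open>S \<union> T\<close>, so by comparison over \<open>u\<close>. It belongs to the part of the
  \<open>Y\<close>-module generated by \<open>T\<close> that lies in \<open>N'\<close>; this part has a finite set \<open>G\<close> of generators, to
  which the hypothesis on the cyclic module applies.
\<close>

lemma undistorted_modulo_extension:
  assumes "finite Z" "Y \<subseteq> Z" "Z \<subseteq> Ops" "finite S" "submodule Z N"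
    and N': "N' = gen Z ({u} \<union> N)"
    and quotient: "undistorted_modulo Y Z S N'"
    and cyclic: "undistorted_modulo Y Z {u} N"
  shows "undistorted_modulo Y Z S N"
  unfolding undistorted_modulo_def
proof (intro allI impI)
  fix T assume T: "finite T" "T \<subseteq> gen Z (S \<union> N)"
  have Y: "finite Y" "Y \<subseteq> Ops" using assms(1-3) finite_subset by auto
  note NY = submodule_subset[OF assms(5,2)]
  have NN': "N \<subseteq> N'" unfolding N' by (auto intro: gen_base)
  have N'Z: "submodule Z N'" unfolding N' by (rule submodule_gen)
  note N'Y = submodule_subset[OF N'Z assms(2)]
  have sub: "subspace N'" using N'Y by (simp add: submodule_def)
  have subg: "subspace (gen Z' R)" for Z' R using submodule_gen by (auto simp: submodule_def)
  have "T \<subseteq> gen Z (S \<union> N')"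
    using T(2) NN' gen_mono[of "S \<union> N" Z "S \<union> N'" Z] gen_base[of _ "S \<union> N'" Z] by blast
  then obtain t1 where t1: "\<And>n. gen Y (T \<union> N') \<inter> filt Z (S \<union> N') n \<subseteq> filt Y (T \<union> N') (t1 * n + t1)"
    using quotient T(1) unfolding undistorted_modulo_def by blast
  have "finite (S \<union> T)" using assms(4) T(1) by simp
  then obtain c where c: "\<And>n v. v \<in> N' \<Longrightarrow> v \<in> filt Z ((S \<union> T) \<union> N) n \<Longrightarrow> v \<in> filt Z ({u} \<union> N) (n + c)"
    using filt_comparison[OF assms(1,3) _ assms(5), of "S \<union> T" "{u} \<union> N"] unfolding N' by blast
  obtain G where G: "finite G" "G \<subseteq> N'" "G \<subseteq> gen Y T" "\<And>n. N' \<inter> filt Y T n \<subseteq> filt Y G n"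
    using submodule_filt_generators[OF Y T(1) N'Y] by blast
  obtain t2 where t2: "\<And>n. gen Y (G \<union> N) \<inter> filt Z ({u} \<union> N) n \<subseteq> filt Y (G \<union> N) (t2 * n + t2)"
    using cyclic G(1,2) unfolding undistorted_modulo_def N' by blast
  obtain e where e: "G \<subseteq> filt Y T e" using finite_subset_gen[OF G(1,3)] .
  have "G \<union> N \<subseteq> filt Y (T \<union> N) e"
    using e filt_mono_gens[of T "T \<union> N" Y Y e] by (auto intro: filt_base)
  from filt_trans[OF this subset_refl]
  have GT: "filt Y (G \<union> N) n \<subseteq> filt Y (T \<union> N) (n + e)" for n .
  have bound: "l \<in> filt Y (T \<union> N) (t2 * (n + (t1 * n + t1) + c) + t2 + e + (t1 * n + t1))"
    if l: "l \<in> gen Y (T \<union> N)" "l \<in> filt Z (S \<union> N) n" for l n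
  proof -
    define n1 where "n1 = t1 * n + t1"
    have "l \<in> gen Y (T \<union> N')"
      using l(1) NN' gen_mono[of "T \<union> N" Y "T \<union> N'" Y] gen_base[of _ "T \<union> N'" Y] by blast
    moreover have "l \<in> filt Z (S \<union> N') n"
      using l(2) NN' filt_mono_gens[of "S \<union> N" "S \<union> N'" Z Z n] by blast
    ultimately have "l \<in> filt Y (T \<union> N') n1" using t1 by (auto simp: n1_def)
    then obtain w where w: "w \<in> N'" "l - w \<in> filt Y T n1"
      using filt_Un_submodule[OF Y(2) N'Y] by blast
    have lw: "l - w \<in> filt Y (T \<union> N) n1" using w(2) filt_mono_gens[of T "T \<union> N" Y Y n1] by blast
    have "l - w \<in> filt Z ((S \<union> T) \<union> N) (n + n1)"
      using w(2) filt_mono_gens[of T "(S \<union> T) \<union> N" Y Z n1] assms(2)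
        filt_mono[of n1 "n + n1" "l - w" Z "(S \<union> T) \<union> N"] by auto
    moreover have "l \<in> filt Z ((S \<union> T) \<union> N) (n + n1)"
      using l(2) filt_mono_gens[of "S \<union> N" "(S \<union> T) \<union> N" Z Z n]
        filt_mono[of n "n + n1" l Z "(S \<union> T) \<union> N"] by auto
    ultimately have "l - (l - w) \<in> filt Z ((S \<union> T) \<union> N) (n + n1)"
      using subspace_diff[OF subspace_filt] by blast
    then have w1: "w \<in> filt Z ({u} \<union> N) (n + n1 + c)" using c w(1) by simp
    have "l - (l - w) \<in> gen Y (T \<union> N)"
      using subspace_diff[OF subg l(1) filtI_gen[OF lw]] .
    then have "w \<in> gen Y (T \<union> N)" by simp
    then obtain m where "w \<in> filt Y (T \<union> N) m" by (auto simp: gen_def)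
    then obtain w' where w': "w' \<in> N" "w - w' \<in> filt Y T m"
      using filt_Un_submodule[OF Y(2) NY] by blast
    have "w - w' \<in> N'" using subspace_diff[OF sub w(1)] w'(1) NN' by blast
    then have "w - w' \<in> filt Y G m" using w'(2) G(4) by blast
    then have "w - w' \<in> gen Y (G \<union> N)"
      using filt_mono_gens[of G "G \<union> N" Y Y m] filtI_gen by blast
    from subspace_add[OF subg this, of w'] w'(1) have "w \<in> gen Y (G \<union> N)"
      by (auto intro: gen_base)
    then have "w \<in> filt Y (G \<union> N) (t2 * (n + n1 + c) + t2)" using w1 t2 by blast
    then have "w \<in> filt Y (T \<union> N) (t2 * (n + n1 + c) + t2 + e)" using GT by blast
    then have "w \<in> filt Y (T \<union> N) (t2 * (n + n1 + c) + t2 + e + n1)"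
      by (rule filt_mono[rotated]) simp
    moreover have "l - w \<in> filt Y (T \<union> N) (t2 * (n + n1 + c) + t2 + e + n1)"
      using lw by (rule filt_mono[rotated]) simp
    ultimately have "l - w + w \<in> filt Y (T \<union> N) (t2 * (n + n1 + c) + t2 + e + n1)"
      using subspace_add[OF subspace_filt] by blast
    then show ?thesis by (simp add: n1_def)
  qed
  show "\<exists>t. \<forall>n. gen Y (T \<union> N) \<inter> filt Z (S \<union> N) n \<subseteq> filt Y (T \<union> N) (t * n + t)"
  proof (intro exI[of _ "t2 * (1 + t1 + c) + t2 + e + t1"] allI subsetI)
    fix n l assume "l \<in> gen Y (T \<union> N) \<inter> filt Z (S \<union> N) n"
    then have l: "l \<in> filt Y (T \<union> N) (t2 * (n + (t1 * n + t1) + c) + t2 + e + (t1 * n + t1))"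
      using bound by blast
    show "l \<in> filt Y (T \<union> N) ((t2 * (1 + t1 + c) + t2 + e + t1) * n + (t2 * (1 + t1 + c) + t2 + e + t1))"
      using l by (rule filt_mono[rotated]) (simp add: algebra_simps)
  qed
qed

text \<open>
  Noetherian induction: a maximal counterexample \<open>M\<close> is a proper submodule, so there is a vector \<open>u\<close>
  with prime annihilator modulo \<open>M\<close>. The statement holds modulo \<open>gen Z ({u} \<union> M)\<close> by maximality and for the
  cyclic module by one of the two prime cases.
\<close>

lemma undistorted_modulo_adjoin_one:
  assumes "finite Y" "Y \<subseteq> Ops" "x \<in> Ops" "finite S" "submodule (insert x Y) N" "N \<subseteq> gen (insert x Y) S"
  shows "undistorted_modulo Y (insert x Y) S N"
proof (rule ccontr)
  let ?Z = "insert x Y"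
  let ?bad = "{N. submodule ?Z N \<and> N \<subseteq> gen ?Z S \<and> \<not> undistorted_modulo Y ?Z S N}"
  assume "\<not> undistorted_modulo Y ?Z S N"
  then have "?bad \<noteq> {}" using assms(5,6) by blast
  have Z: "finite ?Z" "?Z \<subseteq> Ops" using assms(1-3) by auto
  from submodules_have_maximal[OF Z assms(4) \<open>?bad \<noteq> {}\<close>]
  obtain M where M: "M \<in> ?bad" and max: "\<And>N. N \<in> ?bad \<Longrightarrow> M \<subseteq> N \<Longrightarrow> N = M" by blast
  have MZ: "submodule ?Z M" "M \<subseteq> gen ?Z S" using M by auto
  note MY = submodule_subset[OF MZ(1) subset_insertI]
  have "gen ?Z S \<noteq> M"
  proof
    assume eq: "gen ?Z S = M"
    have "undistorted_modulo Y ?Z S M"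
      unfolding undistorted_modulo_def
    proof (intro allI impI exI subsetI)
      fix T n l assume T: "T \<subseteq> gen ?Z (S \<union> M)" and l: "l \<in> gen Y (T \<union> M) \<inter> filt ?Z (S \<union> M) n"
      have "gen ?Z (S \<union> M) \<subseteq> M"
        using eq gen_base[of _ S ?Z] by (intro gen_minimal MZ) blast
      then have "l \<in> M" using l filtI_gen by blast
      then show "l \<in> filt Y (T \<union> M) (0 * n + 0)" by (intro filt_base) simp
    qed
    then show False using M by blast
  qed
  then obtain u0 where u0: "u0 \<in> gen ?Z S" "u0 \<notin> M" using MZ(2) by blast
  obtain p where p: "p \<in> Pol ?Z" "p u0 \<notin> M" "prime_modulo ?Z (p u0) M"
    using exists_prime_modulo[OF Z MZ(1) u0(2)] .
  define u where "u = p u0"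
  have u: "u \<in> gen ?Z S" "u \<notin> M" "prime_modulo ?Z u M"
    using p submodule_Pol[OF submodule_gen p(1) u0(1)] by (auto simp: u_def)
  have "undistorted_modulo Y ?Z {u} M"
  proof (cases "\<exists>a\<in>Pol Y. \<exists>d. a ((x ^^ d) u) \<in> gen Y ((\<lambda>j. (x ^^ j) u) ` {..<d} \<union> M) \<and> a u \<notin> M")
    case True
    then show ?thesis
      using undistorted_modulo_prime_algebraic[OF assms(1-3) MZ(1) u(3)] by blast
  next
    case False
    then show ?thesis
      using undistorted_modulo_prime_transcendental[OF assms(1-3) MZ(1)] by blast
  qed
  moreover have "undistorted_modulo Y ?Z S (gen ?Z ({u} \<union> M))"
  proof (rule ccontr)
    let ?M' = "gen ?Z ({u} \<union> M)"
    assume "\<not> undistorted_modulo Y ?Z S ?M'"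
    moreover have "?M' \<subseteq> gen ?Z S" using u(1) MZ(2) by (intro gen_minimal submodule_gen) auto
    moreover have "M \<subseteq> ?M'" "u \<in> ?M'" by (auto intro: gen_base)
    ultimately show False using max[of ?M'] submodule_gen u(2) by blast
  qed
  ultimately have "undistorted_modulo Y ?Z S M"
    using undistorted_modulo_extension[OF Z(1) subset_insertI Z(2) assms(4) MZ(1) refl] by blast
  then show False using M by blast
qed

section \<open>Adjoining finitely many operators\<close>

lemma filt_insert_zero: "filt Z (S \<union> {0}) n = filt Z S n"
proof (rule equalityI)
  have "S \<union> {0} \<subseteq> filt Z S 0" by (auto simp: span_base span_zero)
  from filt_trans[OF this subset_refl] show "filt Z (S \<union> {0}) n \<subseteq> filt Z S n" by simp
qed (rule filt_mono_gens, auto)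

lemma gen_insert_zero: "gen Z (S \<union> {0}) = gen Z S"
  by (simp only: gen_def filt_insert_zero)

text \<open>
  Linear bounds compose. The operators of \<open>W\<close> are removed one at a time; after the first removal the
  ambient module is the one generated by \<open>T\<close>, which is why \<open>S\<close> is arbitrary in the induction.
\<close>

theorem filt_undistorted:
  assumes "finite W" "W \<subseteq> Ops" "finite Y" "Y \<subseteq> Ops" "finite S" "finite T" "T \<subseteq> gen (W \<union> Y) S"
  shows "\<exists>t. \<forall>n. gen Y T \<inter> filt (W \<union> Y) S n \<subseteq> filt Y T (t * n + t)"
  using assms(1,2,5,7)
proof (induction W arbitrary: S rule: finite_induct)
  case empty
  have "submodule Y {0}"
    using Pol_zero[OF Pol_base] assms(4) by (auto simp: submodule_def subset_iff)
  then obtain c where c: "\<And>n v. v \<in> gen Y (T \<union> {0}) \<Longrightarrow> v \<in> filt Y (S \<union> {0}) n \<Longrightarrow> v \<in> filt Y (T \<union> {0}) (n + c)"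
    using filt_comparison[OF assms(3,4) empty(2), of "{0}" "T \<union> {0}"] by blast
  show ?case
  proof (intro exI[of _ "Suc c"] allI subsetI)
    fix n l assume "l \<in> gen Y T \<inter> filt ({} \<union> Y) S n"
    then have "l \<in> filt Y T (n + c)"
      using c[of l n] by (simp only: filt_insert_zero gen_insert_zero) simp
    then show "l \<in> filt Y T (Suc c * n + Suc c)" by (rule filt_mono[rotated]) simp
  qed
next
  case (insert x W)
  let ?Y = "W \<union> Y"
  have Y: "finite ?Y" "?Y \<subseteq> Ops" "x \<in> Ops" using insert.hyps insert.prems assms(3,4) by auto
  have zero: "submodule (insert x ?Y) {0}"
    using Pol_zero[OF Pol_base] Y(2,3) by (auto simp: submodule_def subset_iff)
  have "{0} \<subseteq> gen (insert x ?Y) S" using submodule_gen subspace_0 by (auto simp: submodule_def)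
  from undistorted_modulo_adjoin_one[OF Y insert.prems(2) zero this]
  have "\<exists>t. \<forall>n. gen ?Y T \<inter> filt (insert x ?Y) S n \<subseteq> filt ?Y T (t * n + t)"
    using assms(6) insert.prems(3) unfolding undistorted_modulo_def gen_insert_zero filt_insert_zero
    by simp
  then obtain t1 where t1: "\<And>n. gen ?Y T \<inter> filt (insert x ?Y) S n \<subseteq> filt ?Y T (t1 * n + t1)" by blast
  have "T \<subseteq> gen ?Y T" by (auto intro: gen_base)
  from insert.IH[OF _ assms(6) this] insert.prems(1)
  obtain t2 where t2: "\<And>n. gen Y T \<inter> filt ?Y T n \<subseteq> filt Y T (t2 * n + t2)" by auto
  show ?case
  proof (intro exI[of _ "t2 * t1 + t2"] allI subsetI)
    fix n l assume l: "l \<in> gen Y T \<inter> filt (insert x W \<union> Y) S n"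
    have "l \<in> gen ?Y T" using l gen_mono[of T ?Y T Y] \<open>T \<subseteq> gen ?Y T\<close> by auto
    then have "l \<in> filt ?Y T (t1 * n + t1)" using l t1 by auto
    then have "l \<in> filt Y T (t2 * (t1 * n + t1) + t2)" using l t2 by blast
    then show "l \<in> filt Y T ((t2 * t1 + t2) * n + (t2 * t1 + t2))"
      by (rule filt_mono[rotated]) (simp add: algebra_simps)
  qed
qed

end

section \<open>Commutative algebras\<close>

locale comm_assoc_algebra = assoc_algebra scale one
  for scale :: "'f::field \<Rightarrow> 'a::comm_ring \<Rightarrow> 'a" (infixr "*s" 75) and one :: "'a option"
begin

definition words :: "'a set \<Rightarrow> nat \<Rightarrow> 'a set" where
  "words X n = {foldr (*) (butlast xs) (last xs) | xs. xs \<noteq> [] \<and> set xs \<subseteq> X \<and> length xs \<le> n}"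

definition word_span :: "'a set \<Rightarrow> nat \<Rightarrow> 'a set" where
  "word_span X n = span (words X n)"

lemma words_0: "words X 0 = {}"
  by (auto simp: words_def)

lemma words_Suc: "words X (Suc n) = X \<union> {x * w |x w. x \<in> X \<and> w \<in> words X n}" (is "?L = ?R")
proof (intro equalityI subsetI)
  fix v assume "v \<in> ?L"
  then obtain xs where xs: "v = foldr (*) (butlast xs) (last xs)" "xs \<noteq> []" "set xs \<subseteq> X" "length xs \<le> Suc n"
    by (auto simp: words_def)
  then obtain x ys where ys: "xs = x # ys" by (cases xs) auto
  show "v \<in> ?R"
  proof (cases "ys = []")
    case False
    then have "foldr (*) (butlast ys) (last ys) \<in> words X n" using xs ys by (auto simp: words_def)
    moreover have "v = x * foldr (*) (butlast ys) (last ys)" using xs(1) ys False by simp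
    ultimately show ?thesis using xs(3) ys by auto
  qed (use xs ys in auto)
next
  fix v assume "v \<in> ?R"
  then consider "v \<in> X" | x w where "x \<in> X" "w \<in> words X n" "v = x * w" by blast
  then show "v \<in> ?L"
  proof cases
    case 1
    then show ?thesis unfolding words_def by (intro CollectI exI[of _ "[v]"]) simp
  next
    case 2
    then obtain xs where "w = foldr (*) (butlast xs) (last xs)" "xs \<noteq> []" "set xs \<subseteq> X" "length xs \<le> n"
      by (auto simp: words_def)
    then show ?thesis unfolding words_def using 2 by (intro CollectI exI[of _ "x # xs"]) simp
  qed
qed

lemma words_mono: "m \<le> n \<Longrightarrow> X \<subseteq> Y \<Longrightarrow> words X m \<subseteq> words Y n"
  unfolding words_def by fastforce

lemma word_span_mono: "m \<le> n \<Longrightarrow> X \<subseteq> Y \<Longrightarrow> word_span X m \<subseteq> word_span Y n"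
  unfolding word_span_def by (intro span_mono words_mono)

lemma subspace_word_span: "subspace (word_span X n)"
  by (simp add: word_span_def)

lemma word_span_base: "x \<in> X \<Longrightarrow> x \<in> word_span X (Suc n)"
  by (simp add: word_span_def words_Suc span_base)

lemma subspace_mult_vimage:
  assumes "subspace U"
  shows "subspace {b. b * a \<in> U}"
  using assms unfolding subspace_def by (auto simp: distrib_right scale_mult_left)

lemma word_span_mult_generator:
  assumes "x \<in> X" "b \<in> word_span X n"
  shows "x * b \<in> word_span X (Suc n)"
proof -
  have "words X n \<subseteq> {b. b * x \<in> word_span X (Suc n)}"
    using assms(1) by (auto simp: word_span_def words_Suc mult.commute[of _ x] intro!: span_base)
  from span_minimal[OF this subspace_mult_vimage[OF subspace_word_span]]
  show ?thesis using assms(2) by (auto simp: word_span_def mult.commute)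
qed

lemma word_span_mult:
  assumes "a \<in> word_span X k" "b \<in> word_span X n"
  shows "a * b \<in> word_span X (k + n)"
proof -
  have "words X k \<subseteq> {a. a * b \<in> word_span X (k + n)}"
  proof (induction k)
    case (Suc k)
    show ?case
    proof
      fix v assume "v \<in> words X (Suc k)"
      then consider "v \<in> X" | x w where "x \<in> X" "w \<in> words X k" "v = x * w" by (auto simp: words_Suc)
      then show "v \<in> {a. a * b \<in> word_span X (Suc k + n)}"
      proof cases
        case 1
        then have "v * b \<in> word_span X (Suc n)" using word_span_mult_generator assms(2) by blast
        then show ?thesis using word_span_mono[of "Suc n" "Suc k + n" X X] by auto
      next
        case 2
        then have "w * b \<in> word_span X (k + n)" using Suc.IH by blast
        then show ?thesis using word_span_mult_generator[OF 2(1)] 2(3) by (simp add: mult.assoc)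
      qed
    qed
  qed (simp add: words_0)
  from span_minimal[OF this subspace_mult_vimage[OF subspace_word_span]]
  show ?thesis using assms(1) by (auto simp: word_span_def)
qed

lemma word_span_trans:
  assumes "Y \<subseteq> word_span X k"
  shows "word_span Y n \<subseteq> word_span X (k * n)"
proof -
  have "words Y n \<subseteq> word_span X (k * n)"
  proof (induction n)
    case (Suc n)
    have "Y \<subseteq> word_span X (k * Suc n)" using assms word_span_mono[of k "k * Suc n" X X] by auto
    moreover have "y * w \<in> word_span X (k * Suc n)" if "y \<in> Y" "w \<in> words Y n" for y w
      using word_span_mult[of y X k w "k * n"] that assms Suc.IH by auto
    ultimately show ?case by (auto simp: words_Suc)
  qed (simp add: words_0)
  from span_minimal[OF this subspace_word_span] show ?thesis by (simp only: word_span_def)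
qed

abbreviation ident :: "'a set" where "ident \<equiv> set_option one"

lemma ident_mult: "e \<in> ident \<Longrightarrow> e * x = x"
  using one_identity by (auto simp: elem_set)

lemma degree_filtration_0: "degree_filtration X 0 = span ident"
  by (simp add: degree_filtration_def)

lemma words_ident: "words (ident \<union> X) n \<subseteq> ident \<union> words X n"
proof (induction n)
  case (Suc n)
  show ?case
  proof
    fix v assume "v \<in> words (ident \<union> X) (Suc n)"
    then consider "v \<in> ident" | "v \<in> X" | x w where "x \<in> ident \<union> X" "w \<in> words (ident \<union> X) n" "v = x * w"
      by (auto simp: words_Suc)
    then show "v \<in> ident \<union> words X (Suc n)"
    proof cases
      case 3
      then have w: "w \<in> ident \<union> words X n" using Suc.IH by blast
      show ?thesis
      proof (cases "x \<in> ident")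
        case True
        then show ?thesis using w ident_mult 3(3) words_mono[of n "Suc n" X X] by auto
      next
        case False
        then show ?thesis using w 3 ident_mult[of w x] by (auto simp: words_Suc mult.commute)
      qed
    qed (auto simp: words_Suc)
  qed
qed (simp add: words_0)

text \<open>
  In positive degree the identity may be treated as one more generator, which makes the unital and
  the non-unital case the same. In degree \<open>0\<close> this fails for a unital algebra, since a generator
  has degree \<open>1\<close> and the identity has degree \<open>0\<close>.
\<close>

lemma degree_filtration_Suc: "degree_filtration X (Suc n) = word_span (ident \<union> X) (Suc n)"
proof -
  have "ident \<union> words X (Suc n) = words (ident \<union> X) (Suc n)"
  proof (rule equalityI)
    have "ident \<subseteq> words (ident \<union> X) (Suc n)" by (auto simp: words_Suc)
    then show "ident \<union> words X (Suc n) \<subseteq> words (ident \<union> X) (Suc n)"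
      using words_mono[of "Suc n" "Suc n" X "ident \<union> X"] by blast
  qed (rule words_ident)
  then show ?thesis unfolding degree_filtration_def word_span_def words_def by simp
qed

lemma subalgebra_word_span: "subalgebra (\<Union>n. word_span (ident \<union> X) n)" (is "subalgebra ?G")
proof -
  have E: "\<exists>n. v \<in> word_span (ident \<union> X) n \<and> w \<in> word_span (ident \<union> X) n"
    if vw: "v \<in> ?G" "w \<in> ?G" for v w
  proof -
    obtain m n where "v \<in> word_span (ident \<union> X) m" "w \<in> word_span (ident \<union> X) n" using vw by auto
    then show ?thesis
      using word_span_mono[of m "max m n" "ident \<union> X"] word_span_mono[of n "max m n" "ident \<union> X"]
      by (meson max.cobounded1 max.cobounded2 subset_iff subset_refl)
  qed
  have "subspace ?G"
    unfolding subspace_def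
  proof (intro conjI ballI allI)
    show "0 \<in> ?G" using subspace_0[OF subspace_word_span] by blast
  next
    fix v w assume "v \<in> ?G" "w \<in> ?G"
    then show "v + w \<in> ?G" using E[of v w] subspace_add[OF subspace_word_span] by blast
  next
    fix c v assume "v \<in> ?G"
    then obtain n where "v \<in> word_span (ident \<union> X) n" by blast
    then have "c *s v \<in> word_span (ident \<union> X) n" by (rule subspace_scale[OF subspace_word_span])
    then show "c *s v \<in> ?G" by blast
  qed
  moreover have "v * w \<in> ?G" if vw: "v \<in> ?G" "w \<in> ?G" for v w
  proof -
    obtain n where "v \<in> word_span (ident \<union> X) n" "w \<in> word_span (ident \<union> X) n" using E[OF vw] by blast
    then have "v * w \<in> word_span (ident \<union> X) (n + n)" by (rule word_span_mult)
    then show ?thesis by blast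
  qed
  moreover have "ident \<subseteq> ?G" using word_span_base[of _ "ident \<union> X" 0] by blast
  ultimately show ?thesis by (simp add: subalgebra_def)
qed

lemma generates_word_span:
  assumes "generates X B"
  shows "B \<subseteq> (\<Union>n. word_span (ident \<union> X) n)"
proof -
  have "X \<subseteq> (\<Union>n. word_span (ident \<union> X) n)" using word_span_base[of _ "ident \<union> X" 0] by blast
  from hull_minimal[where S = subalgebra, OF this subalgebra_word_span]
  show ?thesis using assms by (simp add: generates_def)
qed

definition pair_scale :: "'f \<Rightarrow> 'f \<times> 'a \<Rightarrow> 'f \<times> 'a" where
  "pair_scale c v = (c * fst v, c *s snd v)"

text \<open>
  Multiplication by \<open>(0, a)\<close> in the unitization \<open>F \<times> A\<close>, where \<open>(c, b)\<close> stands for \<open>c + b\<close>.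
\<close>

definition mult_op :: "'a \<Rightarrow> 'f \<times> 'a \<Rightarrow> 'f \<times> 'a" where
  "mult_op a v = (0, fst v *s a + a * snd v)"

sublocale unitization: commuting_operators pair_scale "range mult_op"
proof unfold_locales
  fix z z' v w c
  assume z: "z \<in> range mult_op"
  then obtain a where a: "z = mult_op a" by blast
  show "z (v + w) = z v + z w"
    by (simp add: a mult_op_def scale_left_distrib distrib_left)
  show "z (pair_scale c v) = pair_scale c (z v)"
    by (simp add: a mult_op_def pair_scale_def scale_right_distrib scale_mult_right)
  assume "z' \<in> range mult_op"
  then obtain b where b: "z' = mult_op b" by blast
  show "z (z' v) = z' (z v)"
    by (simp add: a b mult_op_def distrib_left scale_mult_right mult.commute[of a b] mult.assoc[symmetric])
qed (auto simp: pair_scale_def algebra_simps scale_right_distrib scale_left_distrib)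

abbreviation unit_vec :: "'f \<times> 'a" where "unit_vec \<equiv> (1, 0)"

text \<open>
  The first component is unrestricted because \<open>(1, 0)\<close> itself has degree \<open>0\<close>; a word
  \<open>x\<^sub>1 \<dots> x\<^sub>k\<close> sends it to \<open>(0, x\<^sub>1 * \<dots> * x\<^sub>k)\<close>.
\<close>

lemma filt_mult_op: "unitization.filt (mult_op ` X) {unit_vec} n = UNIV \<times> word_span X n"
proof (rule equalityI)
  show "unitization.filt (mult_op ` X) {unit_vec} n \<subseteq> UNIV \<times> word_span X n"
  proof (rule unitization.filt_least)
    show "unitization.filtration (mult_op ` X) (\<lambda>n. UNIV \<times> word_span X n)"
    proof (rule unitization.filtrationI)
      show "unitization.subspace (UNIV \<times> word_span X n)" for n
        using subspace_word_span[of X n]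
        by (auto simp: unitization.subspace_def subspace_def pair_scale_def zero_prod_def)
      show "v \<in> UNIV \<times> word_span X n \<Longrightarrow> v \<in> UNIV \<times> word_span X (Suc n)" for n v
        using word_span_mono[of n "Suc n" X X] by auto
      show "z v \<in> UNIV \<times> word_span X (Suc n)"
        if z: "z \<in> mult_op ` X" and v: "v \<in> UNIV \<times> word_span X n" for z n v
      proof -
        obtain x where x: "x \<in> X" "z = mult_op x" using z by blast
        have "fst v *s x \<in> word_span X (Suc n)" "x * snd v \<in> word_span X (Suc n)"
          using word_span_base[OF x(1)] subspace_scale[OF subspace_word_span]
            word_span_mult_generator[OF x(1)] v by (auto simp: mem_Times_iff)
        then show ?thesis using subspace_add[OF subspace_word_span] x(2) by (simp add: mult_op_def)
      qed
    qed
    show "{unit_vec} \<subseteq> UNIV \<times> word_span X 0" using subspace_0[OF subspace_word_span] by simp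
  qed
next
  let ?F = "unitization.filt (mult_op ` X) {unit_vec}"
  have u: "unit_vec \<in> ?F n" for n by (rule unitization.filt_base) simp
  have "words X n \<subseteq> {b. (0, b) \<in> ?F n}" for n
  proof (induction n)
    case (Suc n)
    show ?case
    proof
      fix v assume "v \<in> words X (Suc n)"
      then consider "v \<in> X" | x w where "x \<in> X" "w \<in> words X n" "v = x * w" by (auto simp: words_Suc)
      then show "v \<in> {b. (0, b) \<in> ?F (Suc n)}"
      proof cases
        case 1
        then show ?thesis
          using unitization.filt_op[OF imageI[OF 1] u[of n]] by (simp add: mult_op_def)
      next
        case 2
        then have "(0, w) \<in> ?F n" using Suc.IH by blast
        from unitization.filt_op[OF imageI[OF 2(1)] this] show ?thesis
          using 2(3) by (simp add: mult_op_def)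
      qed
    qed
  qed (simp add: words_0)
  moreover have "subspace {b. (0, b) \<in> ?F n}"
    unfolding subspace_def mem_Collect_eq
  proof (intro conjI ballI allI)
    show "(0, 0) \<in> ?F n"
      using unitization.subspace_0[OF unitization.subspace_filt] by (simp add: zero_prod_def)
  next
    fix a b assume "a \<in> {b. (0, b) \<in> ?F n}" "b \<in> {b. (0, b) \<in> ?F n}"
    then have "(0, a) + (0, b) \<in> ?F n" by (intro unitization.subspace_add[OF unitization.subspace_filt]) auto
    then show "(0, a + b) \<in> ?F n" by simp
  next
    fix c b assume "b \<in> {b. (0, b) \<in> ?F n}"
    then have "pair_scale c (0, b) \<in> ?F n"
      by (intro unitization.subspace_scale[OF unitization.subspace_filt]) auto
    then show "(0, c *s b) \<in> ?F n" by (simp add: pair_scale_def)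
  qed
  ultimately have b: "(0, b) \<in> ?F n" if "b \<in> word_span X n" for b
    using span_minimal that unfolding word_span_def by blast
  show "UNIV \<times> word_span X n \<subseteq> ?F n"
  proof clarify
    fix c b assume "b \<in> word_span X n"
    from unitization.subspace_add[OF unitization.subspace_filt
        unitization.subspace_scale[OF unitization.subspace_filt u, of c] b[OF this]]
    show "(c, b) \<in> ?F n" by (simp add: pair_scale_def)
  qed
qed

lemma word_span_undistorted:
  assumes "finite X" "finite Y"
  shows "\<exists>t. \<forall>n. (\<Union>m. word_span Y m) \<inter> word_span X n \<subseteq> word_span Y (t * n + t)"
proof -
  let ?Y = "mult_op ` Y" and ?X = "mult_op ` X"
  have "{unit_vec} \<subseteq> unitization.gen (?X \<union> ?Y) {unit_vec}" by (auto intro: unitization.gen_base)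
  from unitization.filt_undistorted[OF _ _ _ _ _ _ this]
  obtain t where t: "\<And>n. unitization.gen ?Y {unit_vec} \<inter> unitization.filt (?X \<union> ?Y) {unit_vec} n
      \<subseteq> unitization.filt ?Y {unit_vec} (t * n + t)"
    using assms by auto
  show ?thesis
  proof (intro exI[of _ t] allI subsetI)
    fix n b assume "b \<in> (\<Union>m. word_span Y m) \<inter> word_span X n"
    then obtain m where m: "b \<in> word_span Y m" "b \<in> word_span X n" by blast
    have "(0, b) \<in> unitization.gen ?Y {unit_vec}"
      using m(1) by (auto simp: unitization.gen_def filt_mult_op)
    moreover have "(0, b) \<in> unitization.filt (?X \<union> ?Y) {unit_vec} n"
      using m(2) word_span_mono[of n n X "X \<union> Y"] by (auto simp: filt_mult_op image_Un[symmetric])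
    ultimately show "b \<in> word_span Y (t * n + t)" using t by (auto simp: filt_mult_op)
  qed
qed

text \<open>
  In degree \<open>0\<close> both filtrations consist of the span of the identity. In degree \<open>n \<ge> 1\<close> the additive
  constant \<open>s\<close> is at most \<open>s n\<close>, so that a multiplicative factor suffices.
\<close>

theorem finitely_generated_subalgebra_undistorted:
  assumes "finitely_generated UNIV" "finitely_generated B"
  shows "undistorted UNIV B"
  unfolding undistorted_def
proof (intro conjI assms subset_UNIV allI impI)
  fix X Y assume X: "finite X" "generates X UNIV" and Y: "finite Y" "generates Y B"
  let ?X = "ident \<union> X" and ?Y = "ident \<union> Y"
  have fin: "finite ?X" "finite ?Y" using X Y by auto
  have "\<forall>y. \<exists>k. y \<in> word_span ?X k" using generates_word_span[OF X(2)] by blast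
  then obtain h where h: "\<And>y. y \<in> word_span ?X (h y)" by metis
  define k where "k = Max (insert 0 (h ` ?Y))"
  have "h y \<le> k" if "y \<in> ?Y" for y using that fin(2) by (auto simp: k_def)
  then have "?Y \<subseteq> word_span ?X k" using h word_span_mono[of _ k ?X ?X] by blast
  from word_span_trans[OF this] have k: "word_span ?Y n \<subseteq> word_span ?X (k * n)" for n .
  obtain s where s: "\<And>n. (\<Union>m. word_span ?Y m) \<inter> word_span ?X n \<subseteq> word_span ?Y (s * n + s)"
    using word_span_undistorted[OF fin] by blast
  define t where "t = Suc (k + 2 * s)"
  show "\<exists>t>0. \<forall>n. degree_filtration Y n \<subseteq> degree_filtration X (t * n) \<and>
      B \<inter> degree_filtration X n \<subseteq> degree_filtration Y (t * n)"
  proof (intro exI[of _ t] conjI allI)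
    fix n
    show "degree_filtration Y n \<subseteq> degree_filtration X (t * n)"
    proof (cases n)
      case (Suc m)
      obtain j where j: "t * n = Suc j" using Suc by (auto simp: t_def)
      have "k * n \<le> t * n" by (rule mult_le_mono1) (simp add: t_def)
      then have "word_span ?Y n \<subseteq> word_span ?X (t * n)"
        using k[of n] word_span_mono[of "k * n" "t * n" ?X ?X] by blast
      then show ?thesis using j Suc by (simp add: degree_filtration_Suc)
    qed (simp add: degree_filtration_0)
    show "B \<inter> degree_filtration X n \<subseteq> degree_filtration Y (t * n)"
    proof (cases n)
      case (Suc m)
      obtain j where j: "t * n = Suc j" using Suc by (auto simp: t_def)
      have "s * n + s \<le> t * n" using Suc by (simp add: t_def algebra_simps)
      then have "B \<inter> word_span ?X n \<subseteq> word_span ?Y (t * n)"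
        using s[of n] generates_word_span[OF Y(2)] word_span_mono[of "s * n + s" "t * n" ?Y ?Y] by blast
      then show ?thesis using j Suc by (simp add: degree_filtration_Suc)
    qed (simp add: degree_filtration_0)
  qed (simp add: t_def)
qed

end

theorem theorem3:
  fixes scale :: "'f::field \<Rightarrow> 'a::comm_ring \<Rightarrow> 'a"
    and one :: "'a option"
    and B :: "'a set"
  assumes "assoc_algebra scale one"
    and "assoc_algebra.finitely_generated scale one UNIV"
    and "assoc_algebra.subalgebra scale one B"
    and "assoc_algebra.finitely_generated scale one B"
  shows "assoc_algebra.undistorted scale one UNIV B"
proof -
  interpret comm_assoc_algebra scale one
    using assms(1) by (simp add: comm_assoc_algebra_def)
  show ?thesis using assms(2,4) by (rule finitely_generated_subalgebra_undistorted)
qed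

end
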